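(* Let $U\colon\mathbb{R}^4\to\mathbb{R}$ be given by $$U(x_1,x_2,x_3,x_4)=-x_3(x_1^2+x_2^2)+\tfrac13x_3^3+\tfrac12(x_4-x_3)^2,$$ and consider the family of systems $\ddot u(t)=-\lambda^2U'(u(t))$, $\lambda>0$. Then for every $k\in\mathbb{N}=\{1,2,\dots\}$ the continuum $\mathcal{C}(0,\frac{k}{\sqrt2})$ is not compact in $C_{2\pi}([0,2\pi],\mathbb{R}^4)\times(0,+\infty)$.
   Context: $U'$ is the gradient of $U$. $C_{2\pi}([0,2\pi],\mathbb{R}^4)=\{u\in C([0,2\pi],\mathbb{R}^4):u(0)=u(2\pi)\}$ with the supremum norm topology; points of $\mathbb{R}^4$ are identified with constant functions. $2\pi$-periodic solutions are regarded as pairs $(u,\lambda)\in C_{2\pi}([0,2\pi],\mathbb{R}^4)\times(0,+\infty)$. Let $\mathcal{NT}$ be the set of pairs $(u,\lambda)$ such that $u$ is a nonstationary (nonconstant) $2\pi$-periodic solution of $\ddot u=-\lambda^2U'(u)$, and $\mathrm{cl}(\mathcal{NT})$ its closure in $C_{2\pi}([0,2\pi],\mathbb{R}^4)\times(0,+\infty)$. $\mathcal{C}(0,\lambda_0)$ denotes the connected component of $\mathrm{cl}(\mathcal{NT})$ containing $(0,\lambda_0)$ (that $(0,\frac{k}{\sqrt2})\in\mathrm{cl}(\mathcal{NT})$ is part of the assertion). *)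

theory Defs
  imports "HOL-Analysis.Analysis"
begin

definition grad :: "('a::real_inner \<Rightarrow> real) \<Rightarrow> 'a \<Rightarrow> 'a"
  where "grad f x = (THE D. GDERIV f x :> D)"

lemma grad_eqI:
  assumes "GDERIV f x :> D"
  shows "grad f x = D"
  unfolding grad_def
proof (rule the_equality)
  fix E assume "GDERIV f x :> E"
  with assms have "(\<lambda>h. h \<bullet> E) = (\<lambda>h. h \<bullet> D)"
    unfolding gderiv_def by (rule has_derivative_unique[rotated])
  then show "E = D"
    by (metis vector_eq_ldot)
qed (fact assms)

text \<open>As in \<^const>\<open>cfunspace\<close>, functions on \<open>[0, 2\<pi>]\<close> are extensional: they take the value
  \<^const>\<open>undefined\<close> outside the interval. The metric is the supremum metric.\<close>

definition C2pi :: "(real \<Rightarrow> 'a::euclidean_space) metric"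
  where "C2pi = submetric (cfunspace (top_of_set {0..2*pi}) euclidean_metric) {u. u 0 = u (2*pi)}"

definition const2pi :: "'a \<Rightarrow> real \<Rightarrow> 'a"
  where "const2pi x = restrict (\<lambda>_. x) {0..2*pi}"

definition pair_space :: "((real \<Rightarrow> 'a::euclidean_space) \<times> real) topology"
  where "pair_space = prod_topology (mtopology_of C2pi) (top_of_set {0<..})"

text \<open>An element of \<^const>\<open>C2pi\<close> is a \<open>2\<pi>\<close>-periodic solution if it is the restriction of a
  \<open>2\<pi>\<close>-periodic solution on the whole line; thus the one-sided derivatives at \<open>0\<close> and \<open>2\<pi>\<close>
  agree as well.\<close>

definition periodic_solution :: "('a::euclidean_space \<Rightarrow> real) \<Rightarrow> real \<Rightarrow> (real \<Rightarrow> 'a) \<Rightarrow> bool"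
  where "periodic_solution U l u \<longleftrightarrow>
    (\<exists>v v'. u = restrict v {0..2*pi} \<and>
      (\<forall>t. v (t + 2*pi) = v t) \<and>
      (\<forall>t. (v has_vector_derivative v' t) (at t)) \<and>
      (\<forall>t. (v' has_vector_derivative - (l\<^sup>2 *\<^sub>R grad U (v t))) (at t)))"

definition NT :: "('a::euclidean_space \<Rightarrow> real) \<Rightarrow> ((real \<Rightarrow> 'a) \<times> real) set"
  where "NT U = {(u, l). u \<in> mspace C2pi \<and> 0 < l \<and> periodic_solution U l u \<and>
                          u \<notin> range const2pi}"

definition cl_NT :: "('a::euclidean_space \<Rightarrow> real) \<Rightarrow> ((real \<Rightarrow> 'a) \<times> real) set"
  where "cl_NT U = pair_space closure_of NT U"

definition continuum :: "('a::euclidean_space \<Rightarrow> real) \<Rightarrow> 'a \<Rightarrow> real \<Rightarrow> ((real \<Rightarrow> 'a) \<times> real) set"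
  where "continuum U x l =
    connected_component_of_set (subtopology pair_space (cl_NT U)) (const2pi x, l)"

end

theory Submission
  imports Defs "HOL-Complex_Analysis.Great_Picard"
begin

text \<open>Only even solutions with \<open>x\<^sub>2 = 0\<close> are used. For them the system is cooperative: if \<open>x\<^sub>1 \<ge> 0\<close>,
  \<open>x\<^sub>1\<close> and \<open>x\<^sub>4\<close> increase and \<open>x\<^sub>3\<close> decreases on \<open>[0, \<pi>]\<close>, then so do the images of these functions
  under the Neumann resolvent of a sufficiently shifted right hand side. Prescribing
  \<open>r = (x\<^sub>3(0) - x\<^sub>3(\<pi>)) + (x\<^sub>4(\<pi>) - x\<^sub>4(0))\<close> and treating \<open>\<mu> = \<lambda>\<^sup>2 \<in> [0, 1]\<close> as an
  unknown turns the problem into a fixed point problem on a compact convex set which depends continuously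
  on \<open>r \<in> [0, R]\<close>. Testing with \<open>cos\<close> excludes \<open>\<mu> = 0\<close> and \<open>\<mu> = 1\<close>, and forces \<open>\<mu> = 1/2\<close> when \<open>r = 0\<close>.
  By Schauder's theorem and a separation argument, some connected set of fixed points reaches from
  \<open>r = 0\<close>, that is \<open>(0, 1 / \<surd>2)\<close>, to \<open>r = R\<close>. As \<open>R\<close> is arbitrary, the component is unbounded, hence not
  compact. The substitution \<open>t \<mapsto> k t\<close> gives the result for all \<open>k\<close>.\<close>

subsection \<open>Brouwer's and Schauder's theorems and continuation of fixed points\<close>

text \<open>The second derivative of U at 0 has eigenvalues 2, 0, 0, 0. The eigenvalue 2 lives in
  the (x3, x4) plane and gives 2 \<mu> = 1; the threefold eigenvalue 0 makes 0 a degenerate critical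
  point, so the constant modes have to be eliminated by hand. The mean of the x4 equation gives x3
  and x4 a common mean, the mean of x1 x3 must vanish and fixes its value, and the mean of x1^2 -
  x3^2 must vanish and fixes the amplitude of x1. After division by r the problem at r = 0 is linear
  with a normalised unknown, so stationary solutions are no longer present. Monotonicity serves
  three purposes. The oscillation of a monotone function is the linear quantity f(pi) - f(0), so the
  normalisation keeps the state set convex. A monotone function whose first cosine coefficient
  vanishes is constant, so testing with cos never degenerates. And the slope of a resolvent of a
  monotone function is bounded by its oscillation, so normalising does not destroy
  compactness.\<close>

lemma tendsto_fun_iff:
  fixes f :: "'a \<Rightarrow> 'b \<Rightarrow> 'c::topological_space"
  shows "(f \<longlongrightarrow> l) F \<longleftrightarrow> (\<forall>i. ((\<lambda>x. f x i) \<longlongrightarrow> l i) F)"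
proof -
  have "(f \<longlongrightarrow> l) F \<longleftrightarrow> limitin (product_topology (\<lambda>i. euclidean) UNIV) f l F"
    by (simp add: euclidean_product_topology)
  then show ?thesis
    unfolding limitin_componentwise by simp
qed

lemma compact_Pi_UNIV:
  fixes S :: "'a \<Rightarrow> 'b::topological_space set"
  assumes "\<And>i. compact (S i)"
  shows "compact (Pi UNIV S)"
proof -
  have "compactin (product_topology (\<lambda>i. euclidean) UNIV) (PiE UNIV S)"
    using assms by (simp add: compactin_PiE compactin_euclidean_iff)
  then show ?thesis
    by (simp add: euclidean_product_topology compactin_euclidean_iff PiE_UNIV_domain)
qed

text \<open>Cubes of all dimensions share one type: the dimension will be the size of a finite net
  and becomes known only inside the proof of Schauder's theorem.\<close>

definition nat_cube :: "nat \<Rightarrow> (nat \<Rightarrow> real) set"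
  where "nat_cube n = Pi UNIV (\<lambda>i. if i < n then {0..1} else {0})"

lemma nat_cube_iff:
  "x \<in> nat_cube n \<longleftrightarrow> (\<forall>i<n. 0 \<le> x i \<and> x i \<le> 1) \<and> (\<forall>i\<ge>n. x i = 0)"
  unfolding nat_cube_def Pi_iff
  by (auto simp: not_le[symmetric] split: if_splits; metis atLeastAtMost_iff singletonD)

lemma compact_nat_cube: "compact (nat_cube n)"
  unfolding nat_cube_def by (rule compact_Pi_UNIV) auto

text \<open>Kuhn's lemma on the grid of mesh 1/p finds a cell in which every coordinate carries both
  labels, that is, has one vertex that \<open>f\<close> does not move down and one that it does not
  move up in this coordinate.\<close>

lemma approximate_fixed_point_nat_cube:
  fixes f :: "(nat \<Rightarrow> real) \<Rightarrow> nat \<Rightarrow> real" and p :: nat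
  assumes maps: "\<And>x. x \<in> nat_cube n \<Longrightarrow> f x \<in> nat_cube n" and p: "0 < p"
  shows "\<exists>y \<in> nat_cube n. \<forall>i<n. \<exists>u \<in> nat_cube n. \<exists>v \<in> nat_cube n.
    (\<forall>j. \<bar>u j - y j\<bar> \<le> 1 / p \<and> \<bar>v j - y j\<bar> \<le> 1 / p) \<and> u i \<le> f u i \<and> f v i \<le> v i"
proof -
  define sc :: "(nat \<Rightarrow> nat) \<Rightarrow> nat \<Rightarrow> real" where "sc = (\<lambda>x i. if i < n then x i / p else 0)"
  \<comment> \<open>Kuhn's lemma wants label 0 on the face \<open>x i = 0\<close> and label 1 on the
    face \<open>x i = p\<close>. Both are consistent with the meaning of the labels because
    \<open>f\<close> maps into the cube.\<close>
  define label :: "(nat \<Rightarrow> nat) \<Rightarrow> nat \<Rightarrow> nat" where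
    "label = (\<lambda>x i. if x i = 0 \<or> (x i < p \<and> sc x i \<le> f (sc x) i) then 0 else 1)"
  have sc: "sc x \<in> nat_cube n" if "\<forall>i<n. x i \<le> p" for x
    using that p by (auto simp: nat_cube_iff sc_def)
  have l0: "sc x i \<le> f (sc x) i" if "\<forall>i<n. x i \<le> p" "i < n" "label x i = 0" for x i
    using maps[OF sc[OF that(1)]] that by (auto simp: label_def nat_cube_iff sc_def split: if_splits)
  have l1: "f (sc x) i \<le> sc x i" if "\<forall>i<n. x i \<le> p" "i < n" "label x i \<noteq> 0" for x i
  proof (cases "x i = p")
    case True
    then show ?thesis using maps[OF sc[OF that(1)]] that p by (auto simp: nat_cube_iff sc_def)
  next
    case False
    then show ?thesis using that by (auto simp: label_def split: if_splits)
  qed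
  obtain q where q: "\<forall>i<n. q i < p"
    and rs: "\<forall>i<n. \<exists>r s. (\<forall>j<n. q j \<le> r j \<and> r j \<le> q j + 1) \<and>
      (\<forall>j<n. q j \<le> s j \<and> s j \<le> q j + 1) \<and> label r i \<noteq> label s i"
    by (rule kuhn_lemma[of p n label]) (use p in \<open>auto simp: label_def\<close>)
  have near: "\<bar>sc r j - sc q j\<bar> \<le> 1 / p" if "\<forall>j<n. q j \<le> r j \<and> r j \<le> q j + 1" for r j
  proof (cases "j < n")
    case True
    then have "real (q j) \<le> real (r j)" "real (r j) \<le> real (q j) + 1"
      using that by (auto simp flip: of_nat_Suc)
    then have "\<bar>real (r j) - real (q j)\<bar> \<le> 1" by linarith
    then show ?thesis
      using True p by (simp add: sc_def divide_simps flip: diff_divide_distrib)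
  qed (simp add: sc_def)
  have le: "\<forall>j<n. r j \<le> p" if "\<forall>j<n. q j \<le> r j \<and> r j \<le> q j + 1" for r
  proof (intro allI impI)
    fix j assume "j < n"
    then have "r j \<le> q j + 1" "q j < p" using that q by auto
    then show "r j \<le> p" by simp
  qed
  show ?thesis
  proof (rule bexI[of _ "sc q"], intro allI impI)
    show "sc q \<in> nat_cube n" using q by (intro sc) (simp add: less_imp_le)
  next
    fix i assume i: "i < n"
    obtain r s where r: "\<forall>j<n. q j \<le> r j \<and> r j \<le> q j + 1"
      and s: "\<forall>j<n. q j \<le> s j \<and> s j \<le> q j + 1" and ne: "label r i \<noteq> label s i"
      using rs i by blast
    consider "label r i = 0" "label s i \<noteq> 0" | "label s i = 0" "label r i \<noteq> 0"
      using ne by (auto simp: label_def split: if_splits)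
    then show "\<exists>u \<in> nat_cube n. \<exists>v \<in> nat_cube n.
      (\<forall>j. \<bar>u j - sc q j\<bar> \<le> 1 / p \<and> \<bar>v j - sc q j\<bar> \<le> 1 / p) \<and> u i \<le> f u i \<and> f v i \<le> v i"
    proof cases
      case 1
      then show ?thesis
        using near[OF r] near[OF s] l0[OF le[OF r] i] l1[OF le[OF s] i] sc[OF le[OF r]] sc[OF le[OF s]]
        by (intro bexI[of _ "sc r"] bexI[of _ "sc s"]) auto
    next
      case 2
      then show ?thesis
        using near[OF r] near[OF s] l0[OF le[OF s] i] l1[OF le[OF r] i] sc[OF le[OF r]] sc[OF le[OF s]]
        by (intro bexI[of _ "sc s"] bexI[of _ "sc r"]) auto
    qed
  qed
qed

text \<open>The witnesses u and v of each coordinate approach y as the mesh shrinks. Along a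
  convergent subsequence they share the limit z, where the two opposite inequalities become
  equality.\<close>

lemma brouwer_nat_cube:
  fixes f :: "(nat \<Rightarrow> real) \<Rightarrow> nat \<Rightarrow> real"
  assumes cont: "continuous_on (nat_cube n) f"
    and maps: "\<And>x. x \<in> nat_cube n \<Longrightarrow> f x \<in> nat_cube n"
  shows "\<exists>x \<in> nat_cube n. f x = x"
proof -
  have "\<forall>k. \<exists>y \<in> nat_cube n. \<forall>i<n. \<exists>u \<in> nat_cube n. \<exists>v \<in> nat_cube n.
    (\<forall>j. \<bar>u j - y j\<bar> \<le> 1 / Suc k \<and> \<bar>v j - y j\<bar> \<le> 1 / Suc k) \<and> u i \<le> f u i \<and> f v i \<le> v i"
    by (intro allI approximate_fixed_point_nat_cube maps) auto
  from choice[OF this[unfolded Bex_def]] obtain y where yQ: "\<And>k. y k \<in> nat_cube n"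
    and y: "\<And>k. \<forall>i<n. \<exists>u \<in> nat_cube n. \<exists>v \<in> nat_cube n.
    (\<forall>j. \<bar>u j - y k j\<bar> \<le> 1 / Suc k \<and> \<bar>v j - y k j\<bar> \<le> 1 / Suc k) \<and> u i \<le> f u i \<and> f v i \<le> v i"
    unfolding Bex_def by blast
  obtain z h where z: "z \<in> nat_cube n" and h: "strict_mono (h :: nat \<Rightarrow> nat)" and lim: "(y \<circ> h) \<longlonglongrightarrow> z"
    using compact_nat_cube[of n] yQ unfolding compact_eq_seq_compact_metric by (blast elim: seq_compactE)
  have near: "(\<lambda>k. u k) \<longlonglongrightarrow> z" if "\<And>k j. \<bar>u k j - y (h k) j\<bar> \<le> 1 / Suc (h k)" for u :: "nat \<Rightarrow> nat \<Rightarrow> real"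
    unfolding tendsto_fun_iff
  proof
    fix j
    have "(\<lambda>k. 1 / real (Suc (h k))) \<longlonglongrightarrow> 0"
      using LIMSEQ_subseq_LIMSEQ[OF LIMSEQ_inverse_real_of_nat h] by (simp add: o_def inverse_eq_divide)
    moreover have "\<forall>\<^sub>F k in sequentially. norm (u k j - y (h k) j) \<le> 1 / Suc (h k)"
      using that by (intro always_eventually) auto
    ultimately have "(\<lambda>k. u k j - y (h k) j) \<longlonglongrightarrow> 0"
      by (rule Lim_null_comparison[rotated])
    moreover have "(\<lambda>k. y (h k) j) \<longlonglongrightarrow> z j"
      using lim unfolding tendsto_fun_iff by (simp add: o_def)
    ultimately show "(\<lambda>k. u k j) \<longlonglongrightarrow> z j"
      using tendsto_add by fastforce
  qed
  have limf: "(\<lambda>k. f (u k) i) \<longlonglongrightarrow> f z i" if "\<And>k. u k \<in> nat_cube n" "u \<longlonglongrightarrow> z" for u i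
    using cont that z unfolding continuous_on_sequentially tendsto_fun_iff[of "f \<circ> _"] by (auto simp: o_def)
  have "f z i = z i" for i
  proof (cases "i < n")
    case True
    obtain u v where uv: "\<And>k. u k \<in> nat_cube n" "\<And>k. v k \<in> nat_cube n"
      "\<And>k j. \<bar>u k j - y (h k) j\<bar> \<le> 1 / Suc (h k)" "\<And>k j. \<bar>v k j - y (h k) j\<bar> \<le> 1 / Suc (h k)"
      "\<And>k. u k i \<le> f (u k) i" "\<And>k. f (v k) i \<le> v k i"
    proof -
      have "\<forall>k. \<exists>u v. u \<in> nat_cube n \<and> v \<in> nat_cube n \<and>
          (\<forall>j. \<bar>u j - y (h k) j\<bar> \<le> 1 / Suc (h k) \<and> \<bar>v j - y (h k) j\<bar> \<le> 1 / Suc (h k)) \<and> u i \<le> f u i \<and> f v i \<le> v i"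
        using y True by blast
      then obtain u v where "\<And>k. u k \<in> nat_cube n \<and> v k \<in> nat_cube n \<and>
          (\<forall>j. \<bar>u k j - y (h k) j\<bar> \<le> 1 / Suc (h k) \<and> \<bar>v k j - y (h k) j\<bar> \<le> 1 / Suc (h k)) \<and> u k i \<le> f (u k) i \<and> f (v k) i \<le> v k i"
        by metis
      then show ?thesis by (intro that[of u v]) blast+
    qed
    have u: "u \<longlonglongrightarrow> z" and v: "v \<longlonglongrightarrow> z" using near uv by blast+
    have "z i \<le> f z i"
      by (rule LIMSEQ_le[OF u[unfolded tendsto_fun_iff, rule_format] limf[OF uv(1) u]]) (use uv(5) in blast)
    moreover have "f z i \<le> z i"
      by (rule LIMSEQ_le[OF limf[OF uv(2) v] v[unfolded tendsto_fun_iff, rule_format]]) (use uv(6) in blast)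
    ultimately show ?thesis by simp
  next
    case False
    then show ?thesis using z maps[OF z] by (simp add: nat_cube_iff)
  qed
  then show ?thesis using z by blast
qed


text \<open>A partition of unity subordinate to a finite e-net replaces a value of \<open>f\<close>
  by a convex combination of net points, with error at most e. Iterating on the coefficients instead
  of the points gives a finite-dimensional map to which Brouwer's theorem applies.\<close>

lemma schauder_approximate:
  fixes f :: "'a::real_normed_vector \<Rightarrow> 'a"
  assumes K: "compact K" "convex K" "K \<noteq> {}" and cont: "continuous_on K f"
    and maps: "\<And>x. x \<in> K \<Longrightarrow> f x \<in> K" and e: "0 < e"
  shows "\<exists>x \<in> K. norm (x - f x) \<le> e"
proof -
  obtain C where C: "finite C" "C \<subseteq> K" "K \<subseteq> (\<Union>x\<in>C. ball x e)"
    using compactE_image[OF K(1), of K "\<lambda>x. ball x e"] e by (metis UN_I centre_in_ball open_ball subsetI)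
  obtain n :: nat and x where x: "C = x ` {i. i < n}"
    using finite_imp_nat_seg_image_inj_on[OF C(1)] by blast
  have xK: "x i \<in> K" if "i < n" for i using C x that by auto
  have n: "0 < n" using C x K(3) by (cases "n = 0") auto
  define mu where "mu = (\<lambda>i y. max 0 (e - dist (x i) y))"
  define M where "M = (\<lambda>y. \<Sum>i<n. mu i y)"
  have mu0: "0 \<le> mu i y" for i y by (simp add: mu_def)
  have M: "0 < M y" if y: "y \<in> K" for y
  proof -
    obtain i where "i < n" "dist (x i) y < e" using y C x by auto
    then have "0 < mu i y" "i \<in> {..<n}" by (auto simp: mu_def)
    then show ?thesis unfolding M_def using mu0 by (meson finite_lessThan sum_pos2)
  qed
  define s where "s = (\<lambda>c :: nat \<Rightarrow> real. \<Sum>j<n. c j)"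
  \<comment> \<open>A retraction of the cube onto the standard simplex: missing mass is spread
    evenly, surplus mass is divided away, and the denominator stays at least 1.\<close>
  define N where "N = (\<lambda>c i. (c i + max 0 (1 - s c) / n) / max 1 (s c))"
  define E where "E = (\<lambda>c. \<Sum>i<n. N c i *\<^sub>R x i)"
  define h where "h = (\<lambda>c i. if i < n then mu i (f (E c)) / M (f (E c)) else 0)"
  have N0: "0 \<le> N c i" if "c \<in> nat_cube n" "i < n" for c i
    using that n unfolding N_def by (auto simp: nat_cube_iff intro!: divide_nonneg_pos add_nonneg_nonneg)
  have N1: "(\<Sum>i<n. N c i) = 1" for c
  proof -
    have "(\<Sum>i<n. N c i) = (s c + max 0 (1 - s c)) / max 1 (s c)"
      using n by (simp add: N_def s_def sum.distrib flip: sum_divide_distrib)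
    also have "\<dots> = 1" by (auto simp: max_def)
    finally show ?thesis .
  qed
  have EK: "E c \<in> K" if "c \<in> nat_cube n" for c
    unfolding E_def using N0[OF that] xK by (intro convex_sum K(2) N1) auto
  have fE: "f (E c) \<in> K" if "c \<in> nat_cube n" for c by (intro maps EK that)
  have hsum: "(\<Sum>i<n. h c i) = 1" if "c \<in> nat_cube n" for c
    using M[OF fE[OF that]] by (simp add: h_def M_def flip: sum_divide_distrib)
  have h0: "0 \<le> h c i" if "c \<in> nat_cube n" for c i
    using M[OF fE[OF that]] mu0 by (simp add: h_def)
  have "h c \<in> nat_cube n" if c: "c \<in> nat_cube n" for c
  proof -
    have "h c i \<le> 1" if "i < n" for i
      using member_le_sum[of i "{..<n}" "h c"] h0[OF c] that by (simp add: hsum[OF c])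
    moreover have "h c i = 0" if "i \<ge> n" for i using that by (simp add: h_def)
    ultimately show ?thesis using h0[OF c] by (simp add: nat_cube_iff)
  qed
  moreover have "continuous_on (nat_cube n) h"
  proof -
    have coord: "continuous_on (nat_cube n) (\<lambda>c. c i)" for i
      by (rule continuous_on_product_then_coordinatewise[OF continuous_on_id])
    have cs: "continuous_on (nat_cube n) s"
      unfolding s_def by (intro continuous_on_sum coord)
    have "continuous_on (nat_cube n) E"
      unfolding E_def N_def
      by (intro continuous_on_sum continuous_on_scaleR continuous_on_divide continuous_on_add continuous_on_max
          continuous_on_diff continuous_on_const coord cs) (use n in auto)
    then have cfE: "continuous_on (nat_cube n) (\<lambda>c. f (E c))"
      using continuous_on_compose2[OF cont] EK by blast
    have "continuous_on (nat_cube n) (\<lambda>c. h c i)" for i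
    proof (cases "i < n")
      case True
      show ?thesis unfolding h_def M_def mu_def using True
        by (simp, intro continuous_on_divide continuous_on_sum continuous_on_max continuous_on_diff continuous_on_dist
            continuous_on_const cfE) (use M[OF fE] in \<open>force simp: M_def mu_def\<close>)
    qed (simp add: h_def)
    then show ?thesis by (rule continuous_on_coordinatewise_then_product)
  qed
  ultimately obtain c where c: "c \<in> nat_cube n" "h c = c"
    using brouwer_nat_cube by blast
  have s1: "s c = 1" using hsum[OF c(1)] by (simp add: c s_def)
  have c0: "0 \<le> c i" for i using h0[OF c(1), of i] c by simp
  have Ec: "E c = (\<Sum>i<n. c i *\<^sub>R x i)" by (simp add: E_def N_def s1)
  define y where "y = f (E c)"
  \<comment> \<open>Only net points within e of y carry a nonzero weight.\<close>
  have "E c - y = (\<Sum>i<n. c i *\<^sub>R (x i - y))"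
    using s1 by (simp add: Ec s_def scaleR_diff_right sum_subtractf flip: scaleR_left.sum)
  then have "norm (E c - y) \<le> (\<Sum>i<n. norm (c i *\<^sub>R (x i - y)))"
    by (simp only: norm_sum)
  also have "\<dots> \<le> (\<Sum>i<n. c i * e)"
  proof (rule sum_mono)
    fix i assume i: "i \<in> {..<n}"
    show "norm (c i *\<^sub>R (x i - y)) \<le> c i * e"
    proof (cases "dist (x i) y < e")
      case True
      then show ?thesis using c0[of i] by (simp add: dist_norm mult_left_mono)
    next
      case False
      then have "mu i y = 0" by (simp add: mu_def)
      then have "h c i = 0" by (simp add: h_def y_def)
      then show ?thesis using c by simp
    qed
  qed
  also have "\<dots> = e" using s1 by (simp add: s_def flip: sum_distrib_right)
  finally show ?thesis using EK[OF c(1)] by (auto simp: y_def)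
qed

theorem schauder:
  fixes f :: "'a::real_normed_vector \<Rightarrow> 'a"
  assumes K: "compact K" "convex K" "K \<noteq> {}" and cont: "continuous_on K f"
    and maps: "\<And>x. x \<in> K \<Longrightarrow> f x \<in> K"
  shows "\<exists>x \<in> K. f x = x"
proof -
  have "continuous_on K (\<lambda>x. norm (x - f x))"
    by (intro continuous_intros cont)
  then obtain x where x: "x \<in> K" "\<And>y. y \<in> K \<Longrightarrow> norm (x - f x) \<le> norm (y - f y)"
    using continuous_attains_inf[OF K(1,3)] by blast
  have "norm (x - f x) \<le> 0"
  proof (rule field_le_epsilon)
    fix e :: real assume "0 < e"
    then obtain y where "y \<in> K" "norm (y - f y) \<le> e"
      using schauder_approximate[OF K cont maps] by blast
    then show "norm (x - f x) \<le> 0 + e" using x(2)[of y] by simp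
  qed
  then show ?thesis using x(1) by (intro bexI[of _ x]) auto
qed

text \<open>If the fixed points over the two ends were separated by a clopen set, letting a Urysohn
  function push the parameter away from the end that each piece contains would
  produce a self-map of the product without fixed points.\<close>

theorem fixed_point_continuation:
  fixes T :: "real \<Rightarrow> 'a::real_normed_vector \<Rightarrow> 'a"
  assumes K: "compact K" "convex K" "K \<noteq> {}" and "a < b"
    and cont: "continuous_on ({a..b} \<times> K) (\<lambda>(r, x). T r x)"
    and maps: "\<And>r x. r \<in> {a..b} \<Longrightarrow> x \<in> K \<Longrightarrow> T r x \<in> K"
  shows "\<exists>C. connected C \<and> C \<subseteq> {(r, x). r \<in> {a..b} \<and> x \<in> K \<and> T r x = x} \<and>
    (\<exists>x. (a, x) \<in> C) \<and> (\<exists>x. (b, x) \<in> C)"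
proof (rule ccontr)
  assume no: "\<not> ?thesis"
  define D where "D = {a..b} \<times> K"
  define Z where "Z = {z \<in> D. (case z of (r, x) \<Rightarrow> T r x) = snd z}"
  have cD: "compact D" unfolding D_def using K by (intro compact_Times) auto
  have "compact Z"
  proof -
    have "continuous_on D (\<lambda>z. (case z of (r, x) \<Rightarrow> T r x) - snd z)"
      using cont unfolding D_def by (intro continuous_intros)
    from continuous_closedin_preimage_constant[OF this, of 0]
    show ?thesis unfolding Z_def by (intro closedin_compact[OF cD]) simp
  qed
  define A where "A = Z \<inter> {a} \<times> UNIV"
  define B where "B = Z \<inter> {b} \<times> UNIV"
  \<comment> \<open>In a compact Hausdorff space, two closed sets that no connected set meets
    simultaneously lie in complementary clopen sets.\<close>
  have "separated_between (top_of_set Z) A B"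
  proof (rule cut_wire_fence_theorem)
    show "compact_space (top_of_set Z)" using \<open>compact Z\<close> by (simp add: compact_space_subtopology)
    show "Hausdorff_space (top_of_set Z)" by (simp add: Hausdorff_space_subtopology)
    show "closedin (top_of_set Z) A" "closedin (top_of_set Z) B"
      unfolding A_def B_def by (intro closedin_closed_Int closed_Times; simp)+
    fix C assume C: "connectedin (top_of_set Z) C"
    then have "connected C" "C \<subseteq> Z" by (auto simp: connectedin_subtopology)
    then have "C \<subseteq> {(r, x). r \<in> {a..b} \<and> x \<in> K \<and> T r x = x}"
      unfolding Z_def D_def by auto
    with no \<open>connected C\<close> have "\<not> ((\<exists>x. (a, x) \<in> C) \<and> (\<exists>x. (b, x) \<in> C))" by blast
    then show "disjnt C A \<or> disjnt C B"
      unfolding A_def B_def disjnt_iff by auto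
  qed
  then obtain U V where UV: "closedin (top_of_set Z) U" "closedin (top_of_set Z) V" "U \<union> V = Z"
      "disjnt U V" "A \<subseteq> U" "B \<subseteq> V"
    by (auto simp: separated_between_alt)
  then have "closed U" "closed V"
    using closedin_compact[OF \<open>compact Z\<close>] compact_imp_closed by blast+
  obtain g where "continuous_map euclidean (top_of_set {a..b}) g" and gV: "g ` V \<subseteq> {a}" and gU: "g ` U \<subseteq> {b}"
    using Urysohn_lemma[of "euclidean :: (real \<times> 'a) topology" V U a b]
      \<open>closed U\<close> \<open>closed V\<close> UV(4) \<open>a < b\<close> metrizable_imp_normal_space[OF metrizable_space_euclidean]
    by (auto simp: disjnt_sym)
  then have g: "continuous_on UNIV g" "\<And>z. g z \<in> {a..b}" "\<And>z. z \<in> U \<Longrightarrow> g z = b" "\<And>z. z \<in> V \<Longrightarrow> g z = a"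
    by (auto simp: continuous_map_in_subtopology)
  define F where "F = (\<lambda>z. (g z, case z of (r, x) \<Rightarrow> T r x))"
  have "\<exists>z \<in> D. F z = z"
  proof (rule schauder)
    show "compact D" by fact
    show "convex D" unfolding D_def using K by (intro convex_Times) auto
    show "D \<noteq> {}" using K \<open>a < b\<close> by (auto simp: D_def)
    show "continuous_on D F"
      unfolding F_def D_def by (intro continuous_on_Pair cont continuous_on_subset[OF g(1)]) auto
    show "F z \<in> D" if "z \<in> D" for z
      using that maps g(2)[of z] \<open>a < b\<close> by (auto simp: F_def D_def)
  qed
  then obtain z where z: "z \<in> D" "F z = z" by blast
  then have "z \<in> Z" by (cases z) (auto simp: Z_def F_def)
  show False
  proof (cases "z \<in> U")
    case True
    then have "fst z = b" using g(3) z(2) by (auto simp: F_def split: prod.splits)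
    then have "z \<in> B" using \<open>z \<in> Z\<close> by (cases z) (auto simp: B_def)
    then show False using True UV by (auto simp: disjnt_def)
  next
    case False
    then have "z \<in> V" using \<open>z \<in> Z\<close> UV by blast
    then have "fst z = a" using g(4) z(2) by (auto simp: F_def split: prod.splits)
    then have "z \<in> A" using \<open>z \<in> Z\<close> by (cases z) (auto simp: A_def)
    then show False using False UV by auto
  qed
qed

subsection \<open>Even periodic extension\<close>

text \<open>The even 2 pi-periodic triangle wave. It folds the line onto [0, pi], so
  \<open>g (tri t)\<close> is the even periodic extension of \<open>g\<close>; through arccos, all
  its symmetries are those of cos.\<close>

definition tri :: "real \<Rightarrow> real"
  where "tri t = arccos (cos t)"

lemma tri_bounds [simp]: "0 \<le> tri t" "tri t \<le> pi"
  by (simp_all add: tri_def arccos_lbound arccos_ubound)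

lemma tri_in: "tri t \<in> {0..pi}"
  by simp

lemma tri_id: "t \<in> {0..pi} \<Longrightarrow> tri t = t"
  by (simp add: tri_def arccos_cos)

lemma tri_tri [simp]: "tri (tri t) = tri t"
  by (rule tri_id) simp

lemma tri_0 [simp]: "tri 0 = 0" and tri_pi [simp]: "tri pi = pi"
  by (simp_all add: tri_id)

lemma cos_tri [simp]: "cos (tri t) = cos t"
  by (simp add: tri_def cos_arccos)

lemma sin_tri_eq_0_iff: "sin (tri t) = 0 \<longleftrightarrow> sin t = 0"
proof -
  have "(sin (tri t))\<^sup>2 = (sin t)\<^sup>2"
    by (simp add: sin_squared_eq)
  then show ?thesis by (metis power_eq_0_iff zero_less_numeral power_zero_numeral power2_eq_iff)
qed

lemma tri_eq_ends: "tri t = 0 \<or> tri t = pi" if "sin t = 0"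
  using that sin_gt_zero[of "tri t"] tri_bounds[of t] sin_tri_eq_0_iff[of t]
  by (metis less_irrefl order_less_le)

lemma tri_cong: "cos s = cos t \<Longrightarrow> tri s = tri t"
  by (simp add: tri_def)

lemma continuous_on_tri [continuous_intros]:
  fixes f :: "real \<Rightarrow> real"
  shows "continuous_on S f \<Longrightarrow> continuous_on S (\<lambda>x. tri (f x))"
  unfolding tri_def by (intro continuous_on_arccos continuous_on_cos ballI conjI cos_ge_minus_one cos_le_one)

lemma tri_abs: "\<bar>y\<bar> \<le> pi \<Longrightarrow> tri y = \<bar>y\<bar>"
  using tri_id[of "\<bar>y\<bar>"] tri_cong[of "\<bar>y\<bar>" y] by simp

lemma tri_le_abs: "tri y \<le> \<bar>y\<bar>"
  using tri_abs[of y] tri_bounds(2)[of y] by linarith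

text \<open>At a fold the wave either rises from 0 (\<open>cos t = 1\<close>) or descends from pi
  (\<open>cos t = -1\<close>), symmetrically on both sides.\<close>

lemma tri_shift:
  assumes "sin t = 0"
  shows "tri x - tri t = cos t * tri (x - t)"
proof -
  have "(cos t)\<^sup>2 = 1" using assms sin_cos_squared_add[of t] by simp
  then consider "cos t = 1" | "cos t = -1" by (auto simp: power2_eq_1_iff)
  then show ?thesis
  proof cases
    case 1
    have "cos (x - t) = cos x" using 1 assms by (simp add: cos_diff)
    then show ?thesis using 1 by (simp add: tri_def)
  next
    case 2
    have "cos (x - t) = - cos x" using 2 assms by (simp add: cos_diff)
    then show ?thesis using 2 by (simp add: tri_def arccos_minus)
  qed
qed

lemma DERIV_tri:
  assumes "sin t \<noteq> 0"
  shows "(tri has_real_derivative sgn (sin t)) (at t)"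
proof -
  have ne: "cos t \<noteq> 1" "cos t \<noteq> -1"
    using assms sin_cos_squared_add[of t] by (auto simp: power2_eq_square)
  then have b: "-1 < cos t" "cos t < 1"
    by (simp_all add: order_less_le)
  have "sqrt (1 - (cos t)\<^sup>2) = \<bar>sin t\<bar>"
    using sin_cos_squared_add[of t] by (metis add_diff_cancel_right' real_sqrt_abs)
  moreover have "((\<lambda>t. arccos (cos t)) has_real_derivative inverse (- sqrt (1 - (cos t)\<^sup>2)) * - sin t) (at t)"
    by (rule DERIV_chain2[OF DERIV_arccos DERIV_cos]) (use b in auto)
  ultimately show ?thesis
    unfolding tri_def[abs_def] using assms by (simp add: sgn_if abs_if split: if_splits)
qed

lemma tri_interior: "sin t \<noteq> 0 \<Longrightarrow> tri t \<in> {0<..<pi}"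
  using sin_tri_eq_0_iff[of t] by (cases "tri t = 0 \<or> tri t = pi") (auto simp: order_less_le)

text \<open>Away from the folds this is the chain rule. At a fold the Neumann condition makes the
  one-sided derivative 0, and since \<open>tri\<close> does not expand distances to the fold, the
  composition has derivative 0 as well.\<close>

lemma DERIV_even_extension:
  assumes g: "\<And>t. t \<in> {0..pi} \<Longrightarrow> (g has_real_derivative g' t) (at t within {0..pi})"
    and end0: "g' 0 = 0" "g' pi = 0"
  shows "((\<lambda>t. g (tri t)) has_real_derivative g' (tri t) * sgn (sin t)) (at t)"
proof (cases "sin t = 0")
  case False
  have "(g has_real_derivative g' (tri t)) (at (tri t))"
    using g[of "tri t"] tri_interior[OF False] by (simp add: at_within_Icc_at)
  from DERIV_chain2[OF this DERIV_tri[OF False]] show ?thesis .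
next
  case True
  have ft: "g' (tri t) = 0"
  proof -
    have "tri t = 0 \<or> tri t = pi" using True by (rule tri_eq_ends)
    then show ?thesis using end0 by auto
  qed
  have ct: "\<bar>cos t\<bar> = 1"
    using True sin_cos_squared_add[of t] by (simp add: abs_square_eq_1)
  have "((\<lambda>x. g (tri x)) has_derivative (\<lambda>h. 0)) (at t)"
    unfolding has_derivative_at_alt
  proof (intro conjI allI impI bounded_linear_zero)
    fix e :: real assume "0 < e"
    have "(g has_derivative (\<lambda>h. 0)) (at (tri t) within {0..pi})"
      using g[OF tri_in, of t] unfolding ft has_field_derivative_def by (simp add: lambda_zero)
    then obtain d where d: "0 < d"
      "\<forall>y \<in> {0..pi}. norm (y - tri t) < d \<longrightarrow> norm (g y - g (tri t) - 0) \<le> e * norm (y - tri t)"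
      using \<open>0 < e\<close> unfolding has_derivative_within_alt by blast
    show "\<exists>d>0. \<forall>y. norm (y - t) < d \<longrightarrow> norm (g (tri y) - g (tri t) - 0) \<le> e * norm (y - t)"
    proof (intro exI[of _ d] conjI allI impI d(1))
      fix y assume y: "norm (y - t) < d"
      have le: "\<bar>tri y - tri t\<bar> \<le> \<bar>y - t\<bar>"
        using tri_shift[OF True, of y] ct tri_le_abs[of "y - t"] tri_bounds[of "y - t"]
        by (simp add: abs_mult)
      then have "norm (g (tri y) - g (tri t) - 0) \<le> e * norm (tri y - tri t)"
        using d(2)[rule_format, OF tri_in, of y] y by simp
      also have "\<dots> \<le> e * norm (y - t)" using le \<open>0 < e\<close> by simp
      finally show "norm (g (tri y) - g (tri t) - 0) \<le> e * norm (y - t)" .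
    qed
  qed
  then show ?thesis using ft by (simp add: has_field_derivative_def lambda_zero)
qed

text \<open>To be applied to the derivative of an even extension, which makes that extension twice
  differentiable across the folds.\<close>

lemma DERIV_odd_extension:
  assumes g: "\<And>t. t \<in> {0..pi} \<Longrightarrow> (g has_real_derivative g' t) (at t within {0..pi})"
    and end0: "g 0 = 0" "g pi = 0"
  shows "((\<lambda>t. g (tri t) * sgn (sin t)) has_real_derivative g' (tri t)) (at t)"
proof (cases "sin t = 0")
  case False
  have "(g has_real_derivative g' (tri t)) (at (tri t))"
    using g[of "tri t"] tri_interior[OF False] by (simp add: at_within_Icc_at)
  from DERIV_cmult_right[OF DERIV_chain2[OF this DERIV_tri[OF False]], of "sgn (sin t)"]
  have "((\<lambda>x. g (tri x) * sgn (sin t)) has_real_derivative g' (tri t)) (at t)"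
    using False by (simp add: mult.assoc flip: sgn_mult) 
  moreover have "\<forall>\<^sub>F x in nhds t. g (tri x) * sgn (sin t) = g (tri x) * sgn (sin x)"
  proof -
    have "\<forall>\<^sub>F x in nhds t. sin x * sin t > 0"
      by (rule order_tendstoD) (use False in \<open>auto intro!: tendsto_eq_intros filterlim_ident simp: mult_less_0_iff zero_less_mult_iff\<close>)
    then show ?thesis
      by eventually_elim (auto simp: zero_less_mult_iff)
  qed
  ultimately show ?thesis
    by (subst DERIV_cong_ev[OF refl _ refl]) (auto elim: eventually_mono)
next
  case True
  have ct: "cos t * cos t = 1"
    using True sin_cos_squared_add[of t] by (simp add: power2_eq_square)
  have gt: "g (tri t) = 0"
  proof -
    have "tri t = 0 \<or> tri t = pi" using True by (rule tri_eq_ends)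
    then show ?thesis using end0 by auto
  qed
  have near: "\<forall>\<^sub>F x in at t. \<bar>x - t\<bar> < pi \<and> x \<noteq> t"
    using eventually_at_ball'[of pi t UNIV] by (simp add: dist_real_def abs_minus_commute)
  \<comment> \<open>Across the fold both the increment of \<open>tri\<close> and the sign of sin
    behave like an absolute value against a signed increment. The two effects cancel, leaving the
    one-sided difference quotient of \<open>g\<close>.\<close>
  have 1: "\<forall>\<^sub>F x in at t. (g (tri x) - g (tri t)) / (tri x - tri t)
      = (g (tri x) * sgn (sin x) - g (tri t) * sgn (sin t)) / (x - t)"
    using near
  proof eventually_elim
    case (elim x)
    define y where "y = x - t"
    have y: "\<bar>y\<bar> < pi" "y \<noteq> 0" using elim by (auto simp: y_def)
    have "sin x = sin y * cos t"
      using True ct by (simp add: y_def sin_diff algebra_simps)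
    moreover have "sgn (sin y) = sgn y"
      using y sin_gt_zero[of y] sin_gt_zero[of "-y"] by (cases "y > 0") (auto simp: sgn_if)
    ultimately have sx: "sgn (sin x) = sgn y * cos t"
      using ct by (auto simp: sgn_mult square_eq_1_iff)
    have fx: "tri x - tri t = cos t * \<bar>y\<bar>"
      using tri_shift[OF True, of x] tri_abs[of y] y by (simp add: y_def)
    have "cos t \<noteq> 0" using ct by auto
    have "g (tri x) / (cos t * \<bar>y\<bar>) = g (tri x) * (sgn y * cos t) / y"
      using ct y \<open>cos t \<noteq> 0\<close> by (simp add: divide_simps sgn_if mult.assoc)
    then show ?case by (simp add: gt fx sx True flip: y_def)
  qed
  have lim: "((\<lambda>y. (g y - g (tri t)) / (y - tri t)) \<longlongrightarrow> g' (tri t)) (at (tri t) within {0..pi})"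
    using g[OF tri_in] unfolding has_field_derivative_iff by blast
  \<comment> \<open>Both sides of t are folded to the same side of \<open>tri t\<close>, within
    [0, pi], so a one-sided limit of \<open>g\<close> suffices.\<close>
  have "filterlim tri (at (tri t) within {0..pi}) (at t)"
    unfolding filterlim_at
  proof
    show "\<forall>\<^sub>F x in at t. tri x \<in> {0..pi} \<and> tri x \<noteq> tri t"
      using near
    proof eventually_elim
      case (elim x)
      have "tri x - tri t = cos t * \<bar>x - t\<bar>"
        using tri_shift[OF True, of x] tri_abs[of "x - t"] elim by simp
      moreover have "cos t \<noteq> 0" using ct by auto
      ultimately show ?case using elim by auto
    qed
    have "continuous_on UNIV tri" by (intro continuous_intros)
    then show "(tri \<longlongrightarrow> tri t) (at t)"
      by (simp add: continuous_on_def)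
  qed
  from filterlim_compose[OF lim this]
  have "((\<lambda>x. (g (tri x) - g (tri t)) / (tri x - tri t)) \<longlongrightarrow> g' (tri t)) (at t)" .
  then show ?thesis
    unfolding has_field_derivative_iff using tendsto_cong[OF 1] by simp
qed

subsection \<open>The Neumann resolvent\<close>

definition res_left :: "real \<Rightarrow> (real \<Rightarrow> real) \<Rightarrow> real \<Rightarrow> real"
  where "res_left \<nu> f t = integral {0..t} (\<lambda>s. cosh (\<nu> * s) * f s)"

definition res_right :: "real \<Rightarrow> (real \<Rightarrow> real) \<Rightarrow> real \<Rightarrow> real"
  where "res_right \<nu> f t = integral {t..pi} (\<lambda>s. cosh (\<nu> * (pi - s)) * f s)"

text \<open>\<open>res \<nu> f\<close> is the solution of \<open>\<nu>\<^sup>2 u - u'' = f\<close> with \<open>u'(0) = u'(\<pi>) = 0\<close>, written with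
  its Green function.\<close>

definition res :: "real \<Rightarrow> (real \<Rightarrow> real) \<Rightarrow> real \<Rightarrow> real"
  where "res \<nu> f t = (cosh (\<nu> * (pi - t)) * res_left \<nu> f t + cosh (\<nu> * t) * res_right \<nu> f t)
    / (\<nu> * sinh (\<nu> * pi))"

text \<open>The derivative of \<open>res\<close>: the two terms that come from differentiating the
  integrals cancel each other.\<close>

definition res' :: "real \<Rightarrow> (real \<Rightarrow> real) \<Rightarrow> real \<Rightarrow> real"
  where "res' \<nu> f t = (sinh (\<nu> * t) * res_right \<nu> f t - sinh (\<nu> * (pi - t)) * res_left \<nu> f t)
    / sinh (\<nu> * pi)"

lemma continuous_on_cosh_real [continuous_intros]:
  fixes f :: "'a::topological_space \<Rightarrow> real"
  assumes "continuous_on S f"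
  shows "continuous_on S (\<lambda>x. cosh (f x))"
  unfolding cosh_def by (intro continuous_intros assms)

context
  fixes \<nu> :: real
  assumes \<nu>: "0 < \<nu>"
begin

lemma sinh_nu_pi: "0 < sinh (\<nu> * pi)"
  using \<nu> by simp

text \<open>Up to the factor -\<nu>, this is the Wronskian of cosh(\<nu> t) and cosh(\<nu> (pi -
  t)). It produces the term -f in the second derivative of the resolvent.\<close>

lemma sinh_split:
  "sinh (\<nu> * pi) = sinh (\<nu> * t) * cosh (\<nu> * (pi - t)) + cosh (\<nu> * t) * sinh (\<nu> * (pi - t))"
  using sinh_add[of "\<nu> * t" "\<nu> * (pi - t)"] by (simp flip: distrib_left)

lemma integrable_left:
  "continuous_on {0..pi} f \<Longrightarrow> t \<le> pi \<Longrightarrow> (\<lambda>s. cosh (\<nu> * s) * f s) integrable_on {0..t}"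
  by (intro integrable_continuous_real continuous_intros) (auto elim: continuous_on_subset)

lemma integrable_right:
  "continuous_on {0..pi} f \<Longrightarrow> 0 \<le> t \<Longrightarrow> (\<lambda>s. cosh (\<nu> * (pi - s)) * f s) integrable_on {t..pi}"
  by (intro integrable_continuous_real continuous_intros) (auto elim: continuous_on_subset)

lemma DERIV_res_left:
  assumes "continuous_on {0..pi} f" "t \<in> {0..pi}"
  shows "(res_left \<nu> f has_real_derivative cosh (\<nu> * t) * f t) (at t within {0..pi})"
  unfolding res_left_def[abs_def]
  by (rule integral_has_real_derivative) (use assms in \<open>auto intro!: continuous_intros\<close>)

lemma DERIV_res_right:
  assumes "continuous_on {0..pi} f" "t \<in> {0..pi}"
  shows "(res_right \<nu> f has_real_derivative - (cosh (\<nu> * (pi - t)) * f t)) (at t within {0..pi})"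
  unfolding res_right_def[abs_def]
  by (rule integral_has_real_derivative') (use assms in \<open>auto intro!: continuous_intros\<close>)

lemma DERIV_res:
  assumes f: "continuous_on {0..pi} f" "t \<in> {0..pi}"
  shows "(res \<nu> f has_real_derivative res' \<nu> f t) (at t within {0..pi})"
  unfolding res_def[abs_def]
  apply (rule derivative_eq_intros DERIV_res_left[OF f] DERIV_res_right[OF f] refl)+
  using \<nu> sinh_nu_pi by (auto simp: res'_def field_simps)

lemma DERIV_res':
  assumes f: "continuous_on {0..pi} f" "t \<in> {0..pi}"
  shows "(res' \<nu> f has_real_derivative \<nu>\<^sup>2 * res \<nu> f t - f t) (at t within {0..pi})"
proof -
  have "sinh (\<nu> * pi) = sinh (\<nu> * t) * cosh (\<nu> * (pi - t)) + cosh (\<nu> * t) * sinh (\<nu> * (pi - t))"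
    by (rule sinh_split)
  then have *: "sinh (\<nu> * pi) * f t = sinh (\<nu> * t) * cosh (\<nu> * (pi - t)) * f t + cosh (\<nu> * t) * sinh (\<nu> * (pi - t)) * f t"
    by (simp add: algebra_simps)
  have "(res' \<nu> f has_real_derivative
      ((\<nu> * (cosh (\<nu> * t) * res_right \<nu> f t + cosh (\<nu> * (pi - t)) * res_left \<nu> f t)) - sinh (\<nu> * pi) * f t)
      / sinh (\<nu> * pi)) (at t within {0..pi})"
    unfolding res'_def[abs_def] *
    apply (rule derivative_eq_intros DERIV_res_left[OF f] DERIV_res_right[OF f] refl)+
    using \<nu> sinh_nu_pi by (auto simp: field_simps)
  then show ?thesis
    by (rule DERIV_cong) (use \<nu> sinh_nu_pi in \<open>simp add: res_def field_simps power2_eq_square\<close>)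
qed

lemma res'_ends [simp]: "res' \<nu> f 0 = 0" "res' \<nu> f pi = 0"
  by (simp_all add: res'_def res_left_def res_right_def)

lemma continuous_on_res:
  "continuous_on {0..pi} f \<Longrightarrow> continuous_on {0..pi} (res \<nu> f)"
  by (rule DERIV_continuous_on[OF DERIV_res])

section \<open>Positivity, bounds and monotonicity of the resolvent\<close>

lemma res_nonneg:
  assumes "continuous_on {0..pi} f" "\<And>s. s \<in> {0..pi} \<Longrightarrow> 0 \<le> f s" "t \<in> {0..pi}"
  shows "0 \<le> res \<nu> f t"
  unfolding res_def res_left_def res_right_def using assms \<nu> sinh_nu_pi
  by (intro divide_nonneg_nonneg add_nonneg_nonneg mult_nonneg_nonneg integral_nonneg
      integrable_left integrable_right) auto

lemma res_add:
  assumes "continuous_on {0..pi} f" "continuous_on {0..pi} g" "t \<in> {0..pi}"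
  shows "res \<nu> (\<lambda>s. f s + g s) t = res \<nu> f t + res \<nu> g t"
proof -
  have "res_left \<nu> (\<lambda>s. f s + g s) t = res_left \<nu> f t + res_left \<nu> g t"
    unfolding res_left_def distrib_left using assms by (intro integral_add integrable_left) auto
  moreover have "res_right \<nu> (\<lambda>s. f s + g s) t = res_right \<nu> f t + res_right \<nu> g t"
    unfolding res_right_def distrib_left using assms by (intro integral_add integrable_right) auto
  ultimately show ?thesis by (simp add: res_def add_divide_distrib algebra_simps)
qed

lemma res'_add:
  assumes "continuous_on {0..pi} f" "continuous_on {0..pi} g" "t \<in> {0..pi}"
  shows "res' \<nu> (\<lambda>s. f s + g s) t = res' \<nu> f t + res' \<nu> g t"
proof -
  have "res_left \<nu> (\<lambda>s. f s + g s) t = res_left \<nu> f t + res_left \<nu> g t"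
    unfolding res_left_def distrib_left using assms by (intro integral_add integrable_left) auto
  moreover have "res_right \<nu> (\<lambda>s. f s + g s) t = res_right \<nu> f t + res_right \<nu> g t"
    unfolding res_right_def distrib_left using assms by (intro integral_add integrable_right) auto
  ultimately show ?thesis by (simp add: res'_def diff_divide_distrib add_divide_distrib algebra_simps)
qed

lemma res_scale: "res \<nu> (\<lambda>s. c * f s) t = c * res \<nu> f t"
proof -
  have "res_left \<nu> (\<lambda>s. c * f s) t = c * res_left \<nu> f t"
    unfolding res_left_def by (simp add: mult.left_commute)
  moreover have "res_right \<nu> (\<lambda>s. c * f s) t = c * res_right \<nu> f t"
    unfolding res_right_def by (simp add: mult.left_commute)
  ultimately show ?thesis by (simp add: res_def algebra_simps)
qed

lemma integral_cosh_left: "0 \<le> t \<Longrightarrow> integral {0..t} (\<lambda>s. cosh (\<nu> * s)) = sinh (\<nu> * t) / \<nu>"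
proof (rule integral_unique)
  assume "0 \<le> t"
  have "((\<lambda>s. cosh (\<nu> * s)) has_integral sinh (\<nu> * t) / \<nu> - sinh (\<nu> * 0) / \<nu>) {0..t}"
    by (rule fundamental_theorem_of_calculus[OF \<open>0 \<le> t\<close>])
      (use \<nu> in \<open>auto intro!: derivative_eq_intros simp: field_simps simp flip: has_real_derivative_iff_has_vector_derivative\<close>)
  then show "((\<lambda>s. cosh (\<nu> * s)) has_integral sinh (\<nu> * t) / \<nu>) {0..t}" by simp
qed

lemma integral_cosh_right: "t \<le> pi \<Longrightarrow> integral {t..pi} (\<lambda>s. cosh (\<nu> * (pi - s))) = sinh (\<nu> * (pi - t)) / \<nu>"
proof (rule integral_unique)
  assume "t \<le> pi"
  have "((\<lambda>s. cosh (\<nu> * (pi - s))) has_integral - sinh (\<nu> * (pi - pi)) / \<nu> - - sinh (\<nu> * (pi - t)) / \<nu>) {t..pi}"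
    by (rule fundamental_theorem_of_calculus[OF \<open>t \<le> pi\<close>])
      (use \<nu> in \<open>auto intro!: derivative_eq_intros simp: field_simps simp flip: has_real_derivative_iff_has_vector_derivative\<close>)
  then show "((\<lambda>s. cosh (\<nu> * (pi - s))) has_integral sinh (\<nu> * (pi - t)) / \<nu>) {t..pi}" by simp
qed

lemma res_left_const: "t \<in> {0..pi} \<Longrightarrow> res_left \<nu> (\<lambda>s. c) t = sinh (\<nu> * t) / \<nu> * c"
  by (simp add: res_left_def integral_cosh_left)

lemma res_right_const: "t \<in> {0..pi} \<Longrightarrow> res_right \<nu> (\<lambda>s. c) t = sinh (\<nu> * (pi - t)) / \<nu> * c"
  by (simp add: res_right_def integral_cosh_right)

lemma res_const: "t \<in> {0..pi} \<Longrightarrow> res \<nu> (\<lambda>s. c) t = c / \<nu>\<^sup>2"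
proof -
  assume t: "t \<in> {0..pi}"
  have "cosh (\<nu> * (pi - t)) * (sinh (\<nu> * t) / \<nu> * c) + cosh (\<nu> * t) * (sinh (\<nu> * (pi - t)) / \<nu> * c)
      = sinh (\<nu> * pi) * c / \<nu>"
    unfolding sinh_split[of t] by (simp add: add_divide_distrib algebra_simps)
  then show ?thesis
    unfolding res_def res_left_const[OF t] res_right_const[OF t]
    using \<nu> sinh_nu_pi by (simp add: power2_eq_square)
qed

lemma res'_const: "t \<in> {0..pi} \<Longrightarrow> res' \<nu> (\<lambda>s. c) t = 0"
  by (simp add: res'_def res_left_const res_right_const)

text \<open>Positivity applied to B + f and B - f, together with the image B / \<nu>^2 of the
  constant B.\<close>

lemma res_bound:
  assumes f: "continuous_on {0..pi} f" "\<And>s. s \<in> {0..pi} \<Longrightarrow> \<bar>f s\<bar> \<le> B" and t: "t \<in> {0..pi}"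
  shows "\<bar>res \<nu> f t\<bar> \<le> B / \<nu>\<^sup>2"
proof -
  have "0 \<le> res \<nu> (\<lambda>s. B + c * f s) t" if "\<bar>c\<bar> = 1" for c
  proof (rule res_nonneg[OF _ _ t])
    show "continuous_on {0..pi} (\<lambda>s. B + c * f s)" by (intro continuous_intros f)
    show "0 \<le> B + c * f s" if "s \<in> {0..pi}" for s
      using f(2)[OF that] \<open>\<bar>c\<bar> = 1\<close> by (auto simp: abs_if split: if_splits)
  qed
  moreover have "res \<nu> (\<lambda>s. B + c * f s) t = B / \<nu>\<^sup>2 + c * res \<nu> f t" for c
    using res_add[of "\<lambda>s. B" "\<lambda>s. c * f s" t] f t by (simp add: res_const res_scale continuous_intros)
  ultimately have "\<bar>c\<bar> = 1 \<Longrightarrow> 0 \<le> B / \<nu>\<^sup>2 + c * res \<nu> f t" for c by simp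
  from this[of 1] this[of "-1"] show ?thesis by simp
qed

text \<open>Replacing f s by f t raises the left integral and lowers the right one. For the
  resulting constant the two terms of \<open>res'\<close> cancel exactly.\<close>

lemma res'_nonneg:
  assumes f: "continuous_on {0..pi} f" "mono_on {0..pi} f" and t: "t \<in> {0..pi}"
  shows "0 \<le> res' \<nu> f t"
proof -
  have "res_left \<nu> f t \<le> integral {0..t} (\<lambda>s. cosh (\<nu> * s) * f t)"
    unfolding res_left_def using t f(2)
    by (intro integral_le integrable_left[OF f(1)] integrable_continuous_real continuous_intros)
      (auto intro: mono_onD)
  then have l: "res_left \<nu> f t \<le> sinh (\<nu> * t) / \<nu> * f t" using t by (simp add: integral_cosh_left)
  have "integral {t..pi} (\<lambda>s. cosh (\<nu> * (pi - s)) * f t) \<le> res_right \<nu> f t"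
    unfolding res_right_def using t f(2)
    by (intro integral_le integrable_right[OF f(1)] integrable_continuous_real continuous_intros)
      (auto intro: mono_onD)
  then have "sinh (\<nu> * (pi - t)) / \<nu> * f t \<le> res_right \<nu> f t" using t by (simp add: integral_cosh_right)
  then have "sinh (\<nu> * t) * (sinh (\<nu> * (pi - t)) / \<nu> * f t) \<le> sinh (\<nu> * t) * res_right \<nu> f t"
    using t \<nu> by (intro mult_left_mono) auto
  moreover have "sinh (\<nu> * (pi - t)) * res_left \<nu> f t \<le> sinh (\<nu> * (pi - t)) * (sinh (\<nu> * t) / \<nu> * f t)"
    using l t \<nu> by (intro mult_left_mono) auto
  ultimately show ?thesis
    unfolding res'_def using sinh_nu_pi by (intro divide_nonneg_pos) (auto simp: mult_ac)
qed

text \<open>The kernel of \<open>res'\<close> is bounded by 1: cosh is largest at the end s = t of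
  each integral, and the resulting products are the two nonnegative summands of
  \<open>sinh_split\<close>. The bound by the integral of |f| is therefore uniform in \<nu>.\<close>

lemma res'_bound:
  assumes f: "continuous_on {0..pi} f" and t: "t \<in> {0..pi}"
  shows "\<bar>res' \<nu> f t\<bar> \<le> integral {0..pi} (\<lambda>s. \<bar>f s\<bar>)"
proof -
  have int: "(\<lambda>s. \<bar>f s\<bar>) integrable_on {a..b}" if "0 \<le> a" "b \<le> pi" for a b
    using that f by (intro integrable_continuous_real continuous_intros) (auto elim: continuous_on_subset)
  have "norm (res_left \<nu> f t) \<le> integral {0..t} (\<lambda>s. cosh (\<nu> * t) * \<bar>f s\<bar>)"
    unfolding res_left_def
    by (intro integral_norm_bound_integral integrable_left f integrable_on_mult_right int)
      (use t \<nu> in \<open>auto simp: abs_mult cosh_real_nonneg_le_iff intro!: mult_right_mono\<close>)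
  then have l: "\<bar>res_left \<nu> f t\<bar> \<le> cosh (\<nu> * t) * integral {0..t} (\<lambda>s. \<bar>f s\<bar>)" by simp
  have "norm (res_right \<nu> f t) \<le> integral {t..pi} (\<lambda>s. cosh (\<nu> * (pi - t)) * \<bar>f s\<bar>)"
    unfolding res_right_def
    by (intro integral_norm_bound_integral integrable_right f integrable_on_mult_right int)
      (use t \<nu> in \<open>auto simp: abs_mult cosh_real_nonneg_le_iff intro!: mult_right_mono\<close>)
  then have r: "\<bar>res_right \<nu> f t\<bar> \<le> cosh (\<nu> * (pi - t)) * integral {t..pi} (\<lambda>s. \<bar>f s\<bar>)" by simp
  have p: "0 \<le> sinh (\<nu> * t)" "0 \<le> sinh (\<nu> * (pi - t))" using t \<nu> by auto
  have le: "sinh (\<nu> * t) * cosh (\<nu> * (pi - t)) \<le> sinh (\<nu> * pi)" "sinh (\<nu> * (pi - t)) * cosh (\<nu> * t) \<le> sinh (\<nu> * pi)"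
    using sinh_split[of t] mult_nonneg_nonneg[OF p(1) cosh_real_nonneg[of "\<nu> * (pi - t)"]]
      mult_nonneg_nonneg[OF p(2) cosh_real_nonneg[of "\<nu> * t"]] mult.commute[of "cosh (\<nu> * t)"]
    by simp_all
  have A: "0 \<le> integral {0..t} (\<lambda>s. \<bar>f s\<bar>)" "0 \<le> integral {t..pi} (\<lambda>s. \<bar>f s\<bar>)"
    using t by (auto intro!: integral_nonneg int)
  have "\<bar>sinh (\<nu> * t) * res_right \<nu> f t - sinh (\<nu> * (pi - t)) * res_left \<nu> f t\<bar>
      \<le> sinh (\<nu> * t) * \<bar>res_right \<nu> f t\<bar> + sinh (\<nu> * (pi - t)) * \<bar>res_left \<nu> f t\<bar>"
    using p by (intro order_trans[OF abs_triangle_ineq4]) (simp add: abs_mult)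
  also have "\<dots> \<le> sinh (\<nu> * t) * (cosh (\<nu> * (pi - t)) * integral {t..pi} (\<lambda>s. \<bar>f s\<bar>))
      + sinh (\<nu> * (pi - t)) * (cosh (\<nu> * t) * integral {0..t} (\<lambda>s. \<bar>f s\<bar>))"
    using p l r by (intro add_mono mult_left_mono)
  also have "\<dots> \<le> sinh (\<nu> * pi) * integral {t..pi} (\<lambda>s. \<bar>f s\<bar>) + sinh (\<nu> * pi) * integral {0..t} (\<lambda>s. \<bar>f s\<bar>)"
    unfolding mult.assoc[symmetric] by (intro add_mono mult_right_mono le A)
  also have "\<dots> = sinh (\<nu> * pi) * integral {0..pi} (\<lambda>s. \<bar>f s\<bar>)"
    using Henstock_Kurzweil_Integration.integral_combine[of 0 t pi "\<lambda>s. \<bar>f s\<bar>"] t int[of 0 pi]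
    by (simp add: algebra_simps flip: distrib_left)
  finally show ?thesis
    using sinh_nu_pi by (simp add: res'_def abs_mult field_simps)
qed

lemma integral_res:
  assumes f: "continuous_on {0..pi} f"
  shows "\<nu>\<^sup>2 * integral {0..pi} (res \<nu> f) = integral {0..pi} f"
proof -
  have "((\<lambda>t. \<nu>\<^sup>2 * res \<nu> f t - f t) has_integral res' \<nu> f pi - res' \<nu> f 0) {0..pi}"
    by (rule fundamental_theorem_of_calculus)
      (use DERIV_res'[OF f] in \<open>auto simp flip: has_real_derivative_iff_has_vector_derivative\<close>)
  then have "integral {0..pi} (\<lambda>t. \<nu>\<^sup>2 * res \<nu> f t - f t) = 0" by (simp add: integral_unique)
  moreover have "integral {0..pi} (\<lambda>t. \<nu>\<^sup>2 * res \<nu> f t - f t) = \<nu>\<^sup>2 * integral {0..pi} (res \<nu> f) - integral {0..pi} f"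
    by (subst integral_diff) (auto intro!: integrable_continuous_real continuous_intros continuous_on_res f)
  ultimately show ?thesis by simp
qed

text \<open>Green's identity with u = \<open>res \<nu> f\<close>: the derivative of u' cos + u sin
  is (u'' + u) cos, and both u' and sin vanish at the two ends.\<close>

lemma integral_res_cos:
  assumes f: "continuous_on {0..pi} f"
  shows "(1 + \<nu>\<^sup>2) * integral {0..pi} (\<lambda>t. res \<nu> f t * cos t) = integral {0..pi} (\<lambda>t. f t * cos t)"
proof -
  have "((\<lambda>t. (1 + \<nu>\<^sup>2) * (res \<nu> f t * cos t) - f t * cos t) has_integral
      (res' \<nu> f pi * cos pi + res \<nu> f pi * sin pi) - (res' \<nu> f 0 * cos 0 + res \<nu> f 0 * sin 0)) {0..pi}"
  proof (rule fundamental_theorem_of_calculus)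
    fix t assume t: "t \<in> {0..pi}"
    show "((\<lambda>t. res' \<nu> f t * cos t + res \<nu> f t * sin t) has_vector_derivative
        (1 + \<nu>\<^sup>2) * (res \<nu> f t * cos t) - f t * cos t) (at t within {0..pi})"
      unfolding has_real_derivative_iff_has_vector_derivative[symmetric]
      by (rule derivative_eq_intros DERIV_res[OF f t] DERIV_res'[OF f t] refl)+ (simp add: algebra_simps)
  qed simp
  then have "integral {0..pi} (\<lambda>t. (1 + \<nu>\<^sup>2) * (res \<nu> f t * cos t) - f t * cos t) = 0" by (simp add: integral_unique)
  moreover have "integral {0..pi} (\<lambda>t. (1 + \<nu>\<^sup>2) * (res \<nu> f t * cos t) - f t * cos t)
      = (1 + \<nu>\<^sup>2) * integral {0..pi} (\<lambda>t. res \<nu> f t * cos t) - integral {0..pi} (\<lambda>t. f t * cos t)"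
    by (subst integral_diff) (auto intro!: integrable_continuous_real continuous_intros continuous_on_res f)
  ultimately show ?thesis by simp
qed

lemma res_mvt:
  assumes f: "continuous_on {0..pi} f" and st: "0 \<le> s" "s \<le> t" "t \<le> pi"
  shows "\<exists>x \<in> {0..pi}. res \<nu> f t - res \<nu> f s = res' \<nu> f x * (t - s)"
proof -
  have "(res \<nu> f has_derivative (\<lambda>h. res' \<nu> f x * h)) (at x within {s..t})" if "s \<le> x" "x \<le> t" for x
    using DERIV_subset[OF DERIV_res[OF f], of x "{s..t}"] that st by (auto simp: has_field_derivative_def)
  from mvt_very_simple[OF st(2) this] show ?thesis using st by fastforce
qed

lemma res_mono:
  assumes f: "continuous_on {0..pi} f" "mono_on {0..pi} f"
  shows "mono_on {0..pi} (res \<nu> f)"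
proof (rule mono_onI)
  fix s t :: real assume st: "s \<in> {0..pi}" "t \<in> {0..pi}" "s \<le> t"
  then obtain x where x: "x \<in> {0..pi}" "res \<nu> f t - res \<nu> f s = res' \<nu> f x * (t - s)"
    using res_mvt[OF f(1), of s t] by auto
  then have "0 \<le> res \<nu> f t - res \<nu> f s" using res'_nonneg[OF f x(1)] st by simp
  then show "res \<nu> f s \<le> res \<nu> f t" by simp
qed

lemma res_lipschitz:
  assumes f: "continuous_on {0..pi} f" "\<And>x. x \<in> {0..pi} \<Longrightarrow> \<bar>res' \<nu> f x\<bar> \<le> L"
    and st: "s \<in> {0..pi}" "t \<in> {0..pi}"
  shows "\<bar>res \<nu> f s - res \<nu> f t\<bar> \<le> L * \<bar>s - t\<bar>"
  using st
proof (induction s t rule: linorder_wlog)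
  case (le s t)
  then obtain x where x: "x \<in> {0..pi}" "res \<nu> f t - res \<nu> f s = res' \<nu> f x * (t - s)"
    using res_mvt[OF f(1), of s t] by auto
  then have "\<bar>res \<nu> f t - res \<nu> f s\<bar> = \<bar>res' \<nu> f x\<bar> * \<bar>t - s\<bar>" by (simp add: abs_mult)
  then show ?case using f(2)[OF x(1)] by (simp add: abs_minus_commute mult_right_mono)
qed (simp add: abs_minus_commute)

end

section \<open>The first cosine coefficient as a measure of oscillation\<close>

text \<open>Since \<open>cos\<close> is an eigenfunction of the Neumann problem, \<open>osc_cos\<close> is an eigenvector of the
  adjoint of \<open>res \<nu>\<close>. On increasing functions it measures the oscillation.\<close>

definition osc_cos :: "(real \<Rightarrow> real) \<Rightarrow> real"
  where "osc_cos f = - integral {0..pi} (\<lambda>t. f t * cos t)"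

lemma integral_cos_0_pi: "integral {0..pi} cos = 0"
proof -
  have "(cos has_integral sin pi - sin 0) {0..pi}"
    by (rule fundamental_theorem_of_calculus)
      (auto intro!: derivative_eq_intros simp flip: has_real_derivative_iff_has_vector_derivative)
  then show ?thesis by (simp add: integral_unique)
qed

lemma osc_cos_res:
  "0 < \<nu> \<Longrightarrow> continuous_on {0..pi} f \<Longrightarrow> (1 + \<nu>\<^sup>2) * osc_cos (res \<nu> f) = osc_cos f"
  using integral_res_cos[of \<nu> f] by (simp add: osc_cos_def)

lemma osc_cos_add:
  "continuous_on {0..pi} f \<Longrightarrow> continuous_on {0..pi} g \<Longrightarrow> osc_cos (\<lambda>t. f t + g t) = osc_cos f + osc_cos g"
  unfolding osc_cos_def distrib_right
  by (subst integral_add) (auto intro!: integrable_continuous_real continuous_intros)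

lemma osc_cos_scale: "osc_cos (\<lambda>t. c * f t) = c * osc_cos f"
  by (simp add: osc_cos_def mult.assoc)

lemma osc_cos_shift:
  assumes f: "continuous_on {0..pi} f"
  shows "osc_cos f = integral {0..pi} (\<lambda>t. (f t - c) * - cos t)"
proof -
  have "integral {0..pi} (\<lambda>t. (f t - c) * - cos t) = integral {0..pi} (\<lambda>t. c * cos t - f t * cos t)"
    by (simp add: algebra_simps)
  also have "\<dots> = osc_cos f"
    by (subst integral_diff)
      (auto intro!: integrable_continuous_real continuous_intros f simp: osc_cos_def integral_cos_0_pi)
  finally show ?thesis by simp
qed

text \<open>Both factors change from nonpositive to nonnegative at pi/2. The subtracted constant
  costs nothing, as cos has integral 0.\<close>

lemma mono_cos_integrand_nonneg:
  assumes "mono_on {0..pi} f" "t \<in> {0..pi}"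
  shows "0 \<le> (f t - f (pi/2)) * - cos t"
proof (cases "t \<le> pi/2")
  case True
  then have "f t \<le> f (pi/2)" "0 \<le> cos t"
    using assms mono_onD[OF assms(1), of t "pi/2"] by (auto intro!: cos_ge_zero)
  then show ?thesis by (simp add: mult_nonpos_nonneg)
next
  case False
  then have "f (pi/2) \<le> f t" using assms mono_onD[OF assms(1), of "pi/2" t] by auto
  moreover have "cos t \<le> 0" using False assms cos_monotone_0_pi_le[of "pi/2" t] by simp
  ultimately show ?thesis by (simp add: mult_nonneg_nonpos)
qed

lemma osc_cos_nonneg:
  assumes f: "continuous_on {0..pi} f" "mono_on {0..pi} f"
  shows "0 \<le> osc_cos f"
  unfolding osc_cos_shift[OF f(1), of "f (pi/2)"]
  by (intro integral_nonneg mono_cos_integrand_nonneg f(2) integrable_continuous_real continuous_intros f(1))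

text \<open>A nonnegative continuous integrand with integral 0 vanishes everywhere, in particular at
  the ends, where cos is 1 or -1.\<close>

lemma osc_cos_eq_0:
  assumes f: "continuous_on {0..pi} f" "mono_on {0..pi} f" and 0: "osc_cos f = 0"
  shows "f pi = f 0"
proof -
  have "\<forall>t \<in> {0..pi}. (f t - f (pi/2)) * - cos t = 0"
    using 0 unfolding osc_cos_shift[OF f(1), of "f (pi/2)"]
    by (subst (asm) integral_eq_0_iff) (intro continuous_intros f(1) pi_gt_zero mono_cos_integrand_nonneg[OF f(2)] | assumption)+
  from this[rule_format, of 0] this[rule_format, of pi] show ?thesis by simp
qed

text \<open>Chebyshev's sum inequality for integrals: on each half of \<open>[0, \<pi>]\<close> both \<open>\<bar>f - f (\<pi>/2)\<bar>\<close> and \<open>\<bar>cos\<bar>\<close> decrease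
  towards \<open>\<pi>/2\<close>, and \<open>\<bar>cos\<bar>\<close> has mean at least \<open>1/2\<close>.\<close>

lemma integral_abs_le_osc_cos:
  assumes f: "continuous_on {0..pi} f" "mono_on {0..pi} f"
  shows "integral {0..pi} (\<lambda>t. \<bar>f t - f (pi/2)\<bar>) \<le> 2 * osc_cos f"
proof -
  define g where "g = (\<lambda>t. f t - f (pi/2))"
  have g: "continuous_on {0..pi} g" "mono_on {0..pi} g"
    unfolding g_def using f by (auto intro!: continuous_intros simp: mono_on_def)
  have g0: "g (pi/2) = 0" by (simp add: g_def)
  have ci: "(\<lambda>t. h t) integrable_on {a..b}" if "continuous_on {0..pi} h" "0 \<le> a" "b \<le> pi" for h :: "real \<Rightarrow> real" and a b
    using that by (intro integrable_continuous_real) (auto elim: continuous_on_subset)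
  have Icos: "integral {0..pi/2} (\<lambda>t. cos t - 1/2) = 1 - pi/4" "integral {pi/2..pi} (\<lambda>t. - cos t - 1/2) = 1 - pi/4"
  proof -
    have "((\<lambda>t. cos t - 1/2) has_integral (sin (pi/2) - (pi/2)/2) - (sin 0 - 0/2)) {0..pi/2}"
      by (rule fundamental_theorem_of_calculus)
       (auto intro!: derivative_eq_intros simp flip: has_real_derivative_iff_has_vector_derivative)
    then show "integral {0..pi/2} (\<lambda>t. cos t - 1/2) = 1 - pi/4" by (simp add: integral_unique)
    have "((\<lambda>t. - cos t - 1/2) has_integral (- sin pi - pi/2) - (- sin (pi/2) - (pi/2)/2)) {pi/2..pi}"
      by (rule fundamental_theorem_of_calculus)
       (auto intro!: derivative_eq_intros simp flip: has_real_derivative_iff_has_vector_derivative)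
    then show "integral {pi/2..pi} (\<lambda>t. - cos t - 1/2) = 1 - pi/4" by (simp add: integral_unique)
  qed
  have p: "pi/4 \<le> 1" using pi_less_4 by simp
  have 1: "integral {0..pi/2} (\<lambda>t. \<bar>g t\<bar>) \<le> 2 * integral {0..pi/2} (\<lambda>t. g t * - cos t)"
  proof -
    have gn: "g t \<le> 0" if "t \<in> {0..pi/2}" for t using mono_onD[OF g(2), of t "pi/2"] that g0 by auto
    \<comment> \<open>The point pi/3 is where cos equals 1/2, so g t - g(pi/3) and cos t - 1/2 have
      opposite signs. The added term integrates to -2 g(pi/3) (1 - pi/4), which is nonnegative and
      is dropped at the end. The other half uses 2 pi/3 in the same way.\<close>
    have "integral {0..pi/2} (\<lambda>t. \<bar>g t\<bar> + 2 * (- g (pi/3)) * (cos t - 1/2)) \<le> integral {0..pi/2} (\<lambda>t. 2 * (g t * - cos t))"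
    proof (intro integral_le ci continuous_intros g)
      fix t assume t: "t \<in> {0..pi/2}"
      have "0 \<le> (g (pi/3) - g t) * (cos t - 1/2)"
      proof (cases "t \<le> pi/3")
        case True
        then have "g t \<le> g (pi/3)" "cos (pi/3) \<le> cos t"
          using t by (auto intro!: mono_onD[OF g(2)] cos_monotone_0_pi_le)
        then show ?thesis by (simp add: cos_60)
      next
        case False
        then have "g (pi/3) \<le> g t" "cos t \<le> cos (pi/3)"
          using t by (auto intro!: mono_onD[OF g(2)] cos_monotone_0_pi_le)
        then show ?thesis by (simp add: cos_60 mult_nonpos_nonpos)
      qed
      then show "\<bar>g t\<bar> + 2 * (- g (pi/3)) * (cos t - 1/2) \<le> 2 * (g t * - cos t)"
        using gn[OF t] by (simp add: algebra_simps)
    qed auto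
    also have "integral {0..pi/2} (\<lambda>t. \<bar>g t\<bar> + 2 * (- g (pi/3)) * (cos t - 1/2))
        = integral {0..pi/2} (\<lambda>t. \<bar>g t\<bar>) + 2 * (- g (pi/3)) * (1 - pi/4)"
      by (subst integral_add) (auto intro!: ci continuous_intros g simp: Icos)
    finally have "integral {0..pi/2} (\<lambda>t. \<bar>g t\<bar>) + 2 * (- g (pi/3)) * (1 - pi/4) \<le> 2 * integral {0..pi/2} (\<lambda>t. g t * - cos t)"
      by (simp only: integral_mult_right)
    moreover have "0 \<le> 2 * (- g (pi/3)) * (1 - pi/4)" using gn[of "pi/3"] p by (intro mult_nonneg_nonneg) auto
    ultimately show ?thesis by linarith
  qed
  have 2: "integral {pi/2..pi} (\<lambda>t. \<bar>g t\<bar>) \<le> 2 * integral {pi/2..pi} (\<lambda>t. g t * - cos t)"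
  proof -
    have gn: "0 \<le> g t" if "t \<in> {pi/2..pi}" for t using mono_onD[OF g(2), of "pi/2" t] that g0 by auto
    have c: "cos (2*pi/3) = -1/2" by (simp add: cos_120)
    have "integral {pi/2..pi} (\<lambda>t. \<bar>g t\<bar> + 2 * g (2*pi/3) * (- cos t - 1/2)) \<le> integral {pi/2..pi} (\<lambda>t. 2 * (g t * - cos t))"
    proof (intro integral_le ci continuous_intros g)
      fix t assume t: "t \<in> {pi/2..pi}"
      have "0 \<le> (g t - g (2*pi/3)) * (- cos t - 1/2)"
      proof (cases "t \<le> 2*pi/3")
        case True
        then have "g t \<le> g (2*pi/3)" "cos (2*pi/3) \<le> cos t"
          using t by (auto intro!: mono_onD[OF g(2)] cos_monotone_0_pi_le)
        then show ?thesis by (simp add: c mult_nonpos_nonpos)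
      next
        case False
        then have "g (2*pi/3) \<le> g t" "cos t \<le> cos (2*pi/3)"
          using t by (auto intro!: mono_onD[OF g(2)] cos_monotone_0_pi_le)
        then show ?thesis by (simp add: c)
      qed
      then show "\<bar>g t\<bar> + 2 * g (2*pi/3) * (- cos t - 1/2) \<le> 2 * (g t * - cos t)"
        using gn[OF t] by (simp add: algebra_simps)
    qed auto
    also have "integral {pi/2..pi} (\<lambda>t. \<bar>g t\<bar> + 2 * g (2*pi/3) * (- cos t - 1/2))
        = integral {pi/2..pi} (\<lambda>t. \<bar>g t\<bar>) + 2 * g (2*pi/3) * (1 - pi/4)"
      by (subst integral_add) (auto intro!: ci continuous_intros g simp: Icos)
    finally have "integral {pi/2..pi} (\<lambda>t. \<bar>g t\<bar>) + 2 * g (2*pi/3) * (1 - pi/4) \<le> 2 * integral {pi/2..pi} (\<lambda>t. g t * - cos t)"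
      by (simp only: integral_mult_right)
    moreover have "0 \<le> 2 * g (2*pi/3) * (1 - pi/4)" using gn[of "2*pi/3"] p by (intro mult_nonneg_nonneg) auto
    ultimately show ?thesis by linarith
  qed
  have "integral {0..pi} (\<lambda>t. \<bar>g t\<bar>) = integral {0..pi/2} (\<lambda>t. \<bar>g t\<bar>) + integral {pi/2..pi} (\<lambda>t. \<bar>g t\<bar>)"
    by (rule Henstock_Kurzweil_Integration.integral_combine[symmetric]) (auto intro!: ci continuous_intros g)
  moreover have "integral {0..pi} (\<lambda>t. g t * - cos t) = integral {0..pi/2} (\<lambda>t. g t * - cos t) + integral {pi/2..pi} (\<lambda>t. g t * - cos t)"
    by (rule Henstock_Kurzweil_Integration.integral_combine[symmetric]) (auto intro!: ci continuous_intros g)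
  ultimately show ?thesis
    using 1 2 unfolding osc_cos_shift[OF f(1), of "f (pi/2)"] g_def by linarith
qed

lemma osc_cos_le_osc:
  assumes f: "continuous_on {0..pi} f" "mono_on {0..pi} f"
  shows "osc_cos f \<le> pi * (f pi - f 0)"
proof -
  have "osc_cos f \<le> integral {0..pi} (\<lambda>t. f pi - f 0)"
    unfolding osc_cos_shift[OF f(1), of "f (pi/2)"]
  proof (intro integral_le integrable_continuous_real continuous_intros f(1))
    fix t assume t: "t \<in> {0..pi}"
    have "\<bar>f t - f (pi/2)\<bar> \<le> f pi - f 0"
      using mono_onD[OF f(2), of 0 t] mono_onD[OF f(2), of t pi]
        mono_onD[OF f(2), of 0 "pi/2"] mono_onD[OF f(2), of "pi/2" pi] t by auto
    then have "\<bar>(f t - f (pi/2)) * - cos t\<bar> \<le> (f pi - f 0) * 1"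
      unfolding abs_mult by (intro mult_mono) auto
    then show "(f t - f (pi/2)) * - cos t \<le> f pi - f 0" by simp
  qed
  then show ?thesis by simp
qed

text \<open>A Harnack type inequality: the slope of \<open>res \<nu> f\<close> is controlled by its own oscillation, however
  steep \<open>f\<close> is.\<close>

lemma res'_le_osc:
  assumes \<nu>: "0 < \<nu>" and f: "continuous_on {0..pi} f" "mono_on {0..pi} f" and t: "t \<in> {0..pi}"
  shows "\<bar>res' \<nu> f t\<bar> \<le> 2 * (1 + \<nu>\<^sup>2) * pi * (res \<nu> f pi - res \<nu> f 0)"
proof -
  \<comment> \<open>Constants have slope 0 under the resolvent, so only f - f(pi/2) counts. Its L1
    norm is controlled by the cosine coefficient, which passes through the resolvent with the factor
    1 + \<nu>^2 and is then bounded by the oscillation of the image.\<close>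
  have "res' \<nu> f t = res' \<nu> (\<lambda>s. f s - f (pi/2)) t"
    using res'_add[OF \<nu>, of f "\<lambda>s. - f (pi/2)" t] f(1) t res'_const[OF \<nu> t] by (simp add: continuous_on_const)
  also have "\<bar>\<dots>\<bar> \<le> integral {0..pi} (\<lambda>s. \<bar>f s - f (pi/2)\<bar>)"
    by (intro res'_bound \<nu> t continuous_intros f(1))
  also have "\<dots> \<le> 2 * osc_cos f" by (rule integral_abs_le_osc_cos[OF f])
  also have "\<dots> = 2 * (1 + \<nu>\<^sup>2) * osc_cos (res \<nu> f)" by (simp only: osc_cos_res[OF \<nu> f(1), symmetric] mult.assoc)
  also have "\<dots> \<le> 2 * (1 + \<nu>\<^sup>2) * (pi * (res \<nu> f pi - res \<nu> f 0))"
    by (intro mult_left_mono osc_cos_le_osc continuous_on_res res_mono \<nu> f) auto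
  finally show ?thesis by (simp add: mult_ac)
qed

subsection \<open>Bounded continuous functions\<close>

text \<open>Functions on [0, pi] are represented by functions on the whole line, which gives a
  normed vector space as a type. The sets used below contain only functions that factor through
  \<open>tri\<close>, so the values outside [0, pi] carry no information.\<close>

type_synonym bfun = "real \<Rightarrow>\<^sub>C real"

lemma apply_Bcontfun: "continuous_on UNIV f \<Longrightarrow> (\<And>x. \<bar>f x\<bar> \<le> B) \<Longrightarrow> apply_bcontfun (Bcontfun f) = f"
  for f :: "real \<Rightarrow> real"
  by (intro Bcontfun_inverse bcontfun_normI) auto

lemma abs_bfun_le: "\<bar>apply_bcontfun f t\<bar> \<le> norm f" for f :: bfun
  using norm_bounded[of f t] by simp

lemma bounded_linear_apply_bcontfun: "bounded_linear (\<lambda>f :: bfun. apply_bcontfun f t)"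
  by (rule bounded_linear_intro[where K = 1]) (auto simp: abs_bfun_le)

lemmas continuous_on_apply [continuous_intros] =
  bounded_linear.continuous_on[OF bounded_linear_apply_bcontfun]

lemma bounded_linear_const_bcontfun: "bounded_linear (const_bcontfun :: real \<Rightarrow> bfun)"
  by (rule bounded_linear_intro[where K = 1])
    (auto intro!: bcontfun_eqI norm_bound simp: const_bcontfun.rep_eq)

lemmas continuous_on_const_bcontfun [continuous_intros] =
  bounded_linear.continuous_on[OF bounded_linear_const_bcontfun]

definition bmult :: "bfun \<Rightarrow> bfun \<Rightarrow> bfun"
  where "bmult f g = Bcontfun (\<lambda>t. f t * g t)"

lemma apply_bmult [simp]: "apply_bcontfun (bmult f g) t = f t * g t"
  unfolding bmult_def
  by (subst apply_Bcontfun[where B = "norm f * norm g"])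
    (auto intro!: continuous_intros mult_mono simp: abs_mult abs_bfun_le)

lemma bounded_bilinear_bmult: "bounded_bilinear bmult"
proof (unfold_locales; (rule exI[of _ 1], intro allI)?)
  show "norm (bmult f g) \<le> norm f * norm g * 1" for f g
    by (intro norm_bound) (auto intro!: mult_mono simp: abs_mult abs_bfun_le)
qed (auto intro!: bcontfun_eqI simp: algebra_simps)

lemmas continuous_on_bmult [continuous_intros] =
  bounded_bilinear.continuous_on[OF bounded_bilinear_bmult]

definition Int_pi :: "bfun \<Rightarrow> real"
  where "Int_pi f = integral {0..pi} f"

lemma integrable_bfun [simp]: "apply_bcontfun f integrable_on {a..b}" for f :: bfun
  by (intro integrable_continuous_real) simp

lemma bounded_linear_Int_pi: "bounded_linear Int_pi"
proof (rule bounded_linear_intro[where K = pi])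
  show "norm (Int_pi f) \<le> norm f * pi" for f
    unfolding Int_pi_def using integral_bound[of 0 pi f "norm f"] by (simp add: abs_bfun_le)
qed (simp_all add: Int_pi_def integral_add)

lemmas continuous_on_Int_pi [continuous_intros] =
  bounded_linear.continuous_on[OF bounded_linear_Int_pi]

lemmas Int_pi_linear = bounded_linear.linear[OF bounded_linear_Int_pi]
lemmas Int_pi_simps = linear_add[OF Int_pi_linear] linear_diff[OF Int_pi_linear] linear_scale[OF Int_pi_linear]
  linear_neg[OF Int_pi_linear]

definition osc :: "bfun \<Rightarrow> real"
  where "osc f = f pi - f 0"

lemma bounded_linear_osc: "bounded_linear osc"
  unfolding osc_def[abs_def] by (intro bounded_linear_sub bounded_linear_apply_bcontfun)

lemmas continuous_on_osc [continuous_intros] =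
  bounded_linear.continuous_on[OF bounded_linear_osc]

definition resolvent :: "real \<Rightarrow> bfun \<Rightarrow> bfun"
  where "resolvent \<nu> f = Bcontfun (\<lambda>t. res \<nu> f (tri t))"

lemma apply_resolvent:
  assumes "0 < \<nu>"
  shows "apply_bcontfun (resolvent \<nu> f) t = res \<nu> f (tri t)"
proof -
  have "continuous_on UNIV (\<lambda>t. res \<nu> f (tri t))"
    using tri_in by (intro continuous_on_compose2[OF continuous_on_res[OF assms, of f]] continuous_intros) auto
  moreover have "\<bar>res \<nu> f (tri x)\<bar> \<le> norm f / \<nu>\<^sup>2" for x
    by (intro res_bound assms) (auto simp: abs_bfun_le)
  ultimately show ?thesis unfolding resolvent_def by (subst apply_Bcontfun) auto
qed

lemma apply_resolvent_Icc:
  "0 < \<nu> \<Longrightarrow> t \<in> {0..pi} \<Longrightarrow> apply_bcontfun (resolvent \<nu> f) t = res \<nu> f t"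
  by (simp add: apply_resolvent tri_id)

lemma bounded_linear_resolvent:
  assumes "0 < \<nu>"
  shows "bounded_linear (resolvent \<nu>)"
proof (rule bounded_linear_intro[where K = "1 / \<nu>\<^sup>2"])
  show "resolvent \<nu> (f + g) = resolvent \<nu> f + resolvent \<nu> g" for f g
    using res_add[OF assms, of f g] by (intro bcontfun_eqI) (simp add: apply_resolvent assms)
  show "resolvent \<nu> (c *\<^sub>R f) = c *\<^sub>R resolvent \<nu> f" for c f
    using res_scale[OF assms, of c f] by (intro bcontfun_eqI) (simp add: apply_resolvent assms)
  show "norm (resolvent \<nu> f) \<le> norm f * (1 / \<nu>\<^sup>2)" for f
    using res_bound[OF assms, of f "norm f"] by (intro norm_bound) (simp add: apply_resolvent assms abs_bfun_le)
qed

lemma Int_pi_resolvent: "0 < \<nu> \<Longrightarrow> \<nu>\<^sup>2 * Int_pi (resolvent \<nu> f) = Int_pi f"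
  using integral_res[of \<nu> f] integral_cong[of "{0..pi}" "resolvent \<nu> f" "res \<nu> f"]
  by (simp add: Int_pi_def apply_resolvent_Icc)

abbreviation ocos :: "bfun \<Rightarrow> real"
  where "ocos f \<equiv> osc_cos (apply_bcontfun f)"

lemma ocos_resolvent: "0 < \<nu> \<Longrightarrow> (1 + \<nu>\<^sup>2) * ocos (resolvent \<nu> f) = ocos f"
proof -
  assume \<nu>: "0 < \<nu>"
  have "ocos (resolvent \<nu> f) = osc_cos (res \<nu> f)"
    unfolding osc_cos_def
    by (intro arg_cong[of _ _ uminus] integral_cong) (simp add: apply_resolvent_Icc \<nu>)
  then show ?thesis using osc_cos_res[OF \<nu>, of f] by simp
qed

lemma ocos_add: "ocos (f + g) = ocos f + ocos g"
  using osc_cos_add[of f g] by (simp add: plus_bcontfun.rep_eq)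

lemma ocos_scaleR: "ocos (c *\<^sub>R f) = c * ocos f"
  using osc_cos_scale[of c f] by (simp add: scaleR_bcontfun.rep_eq)

abbreviation incr :: "bfun \<Rightarrow> bool"
  where "incr f \<equiv> mono_on {0..pi} f"

lemma ocos_nonneg: "incr f \<Longrightarrow> 0 \<le> ocos f"
  by (intro osc_cos_nonneg) auto

lemma ocos_eq_0: "incr f \<Longrightarrow> ocos f = 0 \<Longrightarrow> osc f = 0"
  using osc_cos_eq_0[of f] by (simp add: osc_def)

lemma incr_resolvent: "0 < \<nu> \<Longrightarrow> incr f \<Longrightarrow> incr (resolvent \<nu> f)"
  using res_mono[of \<nu> f] by (auto simp: mono_on_def apply_resolvent_Icc)

section \<open>Compact convex sets of Lipschitz functions\<close>

text \<open>Measuring distance by \<open>tri\<close> also forces evenness and periodicity; the bound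
  at 0 makes the set bounded.\<close>

definition lip_funs :: "real \<Rightarrow> bfun set"
  where "lip_funs L = {f :: bfun. \<bar>f 0\<bar> \<le> 1 \<and> (\<forall>s t. \<bar>f s - f t\<bar> \<le> L * \<bar>tri s - tri t\<bar>)}"

lemma lip_funs_tri: "f \<in> lip_funs L \<Longrightarrow> apply_bcontfun f (tri t) = f t"
  unfolding lip_funs_def by (force dest: spec[of _ "tri t"] spec[of _ t])

lemma closed_lip_funs: "closed (lip_funs L)"
  unfolding lip_funs_def
  by (intro closed_Collect_conj closed_Collect_all closed_Collect_le continuous_intros)

lemma convex_linear_eq: "linear h \<Longrightarrow> convex {x. h x = (c::real)}"
  using convex_linear_vimage[of h "{c}"] by (simp add: vimage_def)

lemma convex_linear_le: "linear h \<Longrightarrow> convex {x. h x \<le> (c::real)}"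
  using convex_linear_vimage[of h "{..c}"] by (simp add: vimage_def)

lemma convex_linear_abs_le:
  assumes "linear h" shows "convex {x. \<bar>h x\<bar> \<le> (c::real)}"
proof -
  have "{x. \<bar>h x\<bar> \<le> c} = h -` {-c..c}" by auto
  then show ?thesis using convex_linear_vimage[OF assms, of "{-c..c}"] by simp
qed

lemma linear_apply: "linear (\<lambda>f :: bfun. apply_bcontfun f t)"
  by (rule bounded_linear.linear[OF bounded_linear_apply_bcontfun])

lemma convex_lip_funs: "convex (lip_funs L)"
proof -
  have "lip_funs L = {f :: bfun. \<bar>f 0\<bar> \<le> 1} \<inter> (\<Inter>s. \<Inter>t. {f :: bfun. \<bar>f s - f t\<bar> \<le> L * \<bar>tri s - tri t\<bar>})"
    by (auto simp: lip_funs_def)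
  also have "convex \<dots>"
    by (intro convex_Int convex_INT convex_linear_abs_le linear_compose_sub linear_apply)
  finally show ?thesis .
qed

text \<open>Arzela-Ascoli gives a uniform limit on [0, pi]; composing it with \<open>tri\<close>
  gives the limit on the line.\<close>

lemma compact_lip_funs:
  assumes "0 \<le> L"
  shows "compact (lip_funs L)"
  unfolding compact_eq_seq_compact_metric
proof (rule seq_compactI)
  fix F :: "nat \<Rightarrow> bfun" assume F: "\<forall>n. F n \<in> lip_funs L"
  have lip: "\<bar>F n s - F n t\<bar> \<le> L * \<bar>s - t\<bar>" if "s \<in> {0..pi}" "t \<in> {0..pi}" for n s t
  proof -
    have "\<bar>F n s - F n t\<bar> \<le> L * \<bar>tri s - tri t\<bar>" using F by (simp add: lip_funs_def)
    then show ?thesis using that by (simp add: tri_id)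
  qed
  obtain g and k :: "nat \<Rightarrow> nat" where g: "continuous_on {0..pi} g" and k: "strict_mono k"
    and lim: "\<And>e. 0 < e \<Longrightarrow> \<exists>N. \<forall>n x. n \<ge> N \<and> x \<in> {0..pi} \<longrightarrow> norm (F (k n) x - g x) < e"
  proof (rule Arzela_Ascoli[of "{0..pi}" "\<lambda>n. apply_bcontfun (F n)" "1 + L * pi"])
    fix n x assume x: "x \<in> {0..pi}"
    have "\<bar>F n x - F n 0\<bar> \<le> L * pi"
      using lip[of x 0 n] x assms by (auto intro: order_trans mult_left_mono)
    moreover have "\<bar>F n 0\<bar> \<le> 1" using F by (simp add: lip_funs_def)
    ultimately show "norm (F n x) \<le> 1 + L * pi" by simp
  next
    fix x e :: real assume x: "x \<in> {0..pi}" and e: "0 < e"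
    show "\<exists>d. 0 < d \<and> (\<forall>n y. y \<in> {0..pi} \<and> norm (x - y) < d \<longrightarrow> norm (F n x - F n y) < e)"
    proof (intro exI[of _ "e / (L + 1)"] conjI allI impI)
      show "0 < e / (L + 1)" using e assms by simp
      fix n y assume y: "y \<in> {0..pi} \<and> norm (x - y) < e / (L + 1)"
      have "L * \<bar>x - y\<bar> \<le> (L + 1) * \<bar>x - y\<bar>" by (simp add: algebra_simps)
      also have "\<dots> < e" using y assms by (simp add: field_simps)
      finally show "norm (F n x - F n y) < e" using lip[of x y n] x y by simp
    qed
  qed auto
  have "uniform_limit UNIV (\<lambda>n. apply_bcontfun (F (k n))) (\<lambda>t. g (tri t)) sequentially"
  proof (rule uniform_limitI)
    fix e :: real assume "0 < e"
    then obtain N where N: "\<forall>n x. n \<ge> N \<and> x \<in> {0..pi} \<longrightarrow> norm (F (k n) x - g x) < e"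
      using lim by blast
    have "dist (F (k n) t) (g (tri t)) < e" if "n \<ge> N" for n t
      using N[rule_format, of n "tri t"] that lip_funs_tri[of "F (k n)" L t] F by (simp add: dist_norm)
    then show "\<forall>\<^sub>F n in sequentially. \<forall>x\<in>UNIV. dist (F (k n) x) (g (tri x)) < e"
      unfolding eventually_sequentially by blast
  qed
  from uniform_limit_bcontfunE[OF this] obtain l where l: "(\<lambda>n. F (k n)) \<longlonglongrightarrow> l" by auto
  moreover have "l \<in> lip_funs L"
    using closed_sequentially[OF closed_lip_funs _ l] F by blast
  ultimately show "\<exists>l\<in>lip_funs L. \<exists>r. strict_mono r \<and> (F \<circ> r) \<longlonglongrightarrow> l"
    using k by (auto simp: o_def)
qed

lemma convex_incr: "convex {f :: bfun. incr f}"
proof -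
  have "{f :: bfun. incr f} = (\<Inter>s\<in>{0..pi}. \<Inter>t\<in>{s..pi}. {f :: bfun. f s - f t \<le> 0})"
    by (auto simp: mono_on_def)
  also have "convex \<dots>" by (intro convex_INT convex_linear_le linear_compose_sub linear_apply)
  finally show ?thesis .
qed

lemma closed_incr: "closed {f :: bfun. incr f}"
proof -
  have "{f :: bfun. incr f} = (\<Inter>s\<in>{0..pi}. \<Inter>t\<in>{s..pi}. {f :: bfun. f s - f t \<le> 0})"
    by (auto simp: mono_on_def)
  also have "closed \<dots>" by (intro closed_INT ballI closed_Collect_le continuous_intros)
  finally show ?thesis .
qed

subsection \<open>The fixed point problem\<close>

text \<open>A state \<open>(\<mu>, p, q, s)\<close> encodes \<open>\<mu> = \<lambda>\<^sup>2\<close>, \<open>x\<^sub>1 = r \<surd>(amp2 p q) p\<close>, \<open>x\<^sub>3 = r \<cdot> shift_mean p q\<close> and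
  \<open>x\<^sub>4 = r (s + b)\<close>, where \<open>b\<close> is the common mean of \<open>x\<^sub>3 / r\<close> and \<open>x\<^sub>4 / r\<close>. Here \<open>b\<close> and \<open>amp2\<close> are chosen such
  that \<open>x\<^sub>1 x\<^sub>3\<close> and \<open>x\<^sub>1\<^sup>2 - x\<^sub>3\<^sup>2\<close> have mean zero, as they must for a periodic solution.\<close>

definition shift_mean :: "bfun \<Rightarrow> bfun \<Rightarrow> bfun"
  where "shift_mean p q = const_bcontfun (Int_pi (bmult q p)) - q"

definition amp2 :: "bfun \<Rightarrow> bfun \<Rightarrow> real"
  where "amp2 p q = Int_pi (bmult (shift_mean p q) (shift_mean p q)) / Int_pi (bmult p p)"

text \<open>These right hand sides arise by adding m u, with m = \<nu>^2, to both sides of the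
  equations for -p'', -q'' and -s''. The sign in x3 = r (b - q) makes all three unknowns increasing
  at once.\<close>

definition rhs1 :: "real \<Rightarrow> real \<Rightarrow> real \<Rightarrow> bfun \<Rightarrow> bfun \<Rightarrow> bfun"
  where "rhs1 m r \<mu> p q = m *\<^sub>R p - (2 * \<mu> * r) *\<^sub>R bmult (shift_mean p q) p"

definition quad :: "bfun \<Rightarrow> bfun \<Rightarrow> bfun"
  where "quad p q = amp2 p q *\<^sub>R bmult p p - bmult (shift_mean p q) (shift_mean p q)"

definition rhs3 :: "real \<Rightarrow> real \<Rightarrow> real \<Rightarrow> bfun \<Rightarrow> bfun \<Rightarrow> bfun \<Rightarrow> bfun"
  where "rhs3 m r \<mu> p q s = m *\<^sub>R q + \<mu> *\<^sub>R (r *\<^sub>R quad p q + q + s)"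

definition rhs4 :: "real \<Rightarrow> real \<Rightarrow> bfun \<Rightarrow> bfun \<Rightarrow> bfun"
  where "rhs4 m \<mu> q s = (m + \<mu>) *\<^sub>R s + \<mu> *\<^sub>R q"

definition P_set :: "real \<Rightarrow> bfun set"
  where "P_set L = lip_funs L \<inter> {f. incr f} \<inter> {f :: bfun. 0 \<le> f 0} \<inter> {f. Int_pi f = 1}"

definition Q_set :: "real \<Rightarrow> bfun set"
  where "Q_set L = lip_funs L \<inter> {f. incr f} \<inter> {f. Int_pi f = 0}"

text \<open>Since x3 = r (b - q) and x4 = r (s + b), the normalisation makes r the prescribed total
  oscillation and excludes q = s = 0 even when r = 0. As \<open>osc\<close> is linear, the set is
  convex, which a norm sphere would not be.\<close>

definition QS_set :: "real \<Rightarrow> (bfun \<times> bfun) set"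
  where "QS_set L = Q_set L \<times> Q_set L \<inter> {(q, s). osc q + osc s = 1}"

definition states :: "real \<Rightarrow> (real \<times> bfun \<times> bfun \<times> bfun) set"
  where "states L = {0..1} \<times> P_set L \<times> QS_set L"

lemma compact_states: "0 \<le> L \<Longrightarrow> compact (states L)"
proof -
  assume L: "0 \<le> L"
  have "compact (P_set L)" "compact (Q_set L)"
    unfolding P_set_def Q_set_def
    by (intro compact_Int_closed compact_lip_funs L closed_incr closed_Collect_le closed_Collect_eq continuous_intros)+
  moreover have "closed {(q :: bfun, s). osc q + osc s = 1}"
    unfolding case_prod_unfold by (intro closed_Collect_eq continuous_intros)
  ultimately show ?thesis
    unfolding states_def QS_set_def by (intro compact_Times compact_Int_closed compact_Icc)
qed

lemma convex_states: "convex (states L)"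
proof -
  have "convex (P_set L)" "convex (Q_set L)"
    unfolding P_set_def Q_set_def using convex_linear_le[OF linear_compose_neg[OF linear_apply[of 0]], of 0]
    by (auto intro!: convex_Int convex_lip_funs convex_incr convex_linear_eq Int_pi_linear)
  moreover have "convex {(q, s). osc q + osc s = 1}"
  proof -
    have "linear (\<lambda>z. osc (fst z) + osc (snd z))"
      by (intro linear_compose_add linear_compose[OF _ bounded_linear.linear[OF bounded_linear_osc], unfolded o_def]
          bounded_linear.linear bounded_linear_fst bounded_linear_snd)
    from convex_linear_eq[OF this] show ?thesis by (simp add: case_prod_unfold)
  qed
  ultimately show ?thesis
    unfolding states_def QS_set_def by (intro convex_Times convex_Int convex_real_interval)
qed

definition osc_sum :: "real \<Rightarrow> real \<Rightarrow> real \<times> bfun \<times> bfun \<times> bfun \<Rightarrow> real"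
  where "osc_sum \<nu> r = (\<lambda>(\<mu>, p, q, s).
    osc (resolvent \<nu> (rhs3 (\<nu>\<^sup>2) r \<mu> p q s)) + osc (resolvent \<nu> (rhs4 (\<nu>\<^sup>2) \<mu> q s)))"

text \<open>The unknown \<open>\<mu>\<close> is driven by the normalising factor \<open>osc_sum\<close>: at a fixed point with \<open>0 < \<mu> < 1\<close> the
  factor is \<open>1\<close>, so the normalised equations are the original ones.\<close>

definition step :: "real \<Rightarrow> real \<Rightarrow> real \<times> bfun \<times> bfun \<times> bfun \<Rightarrow> real \<times> bfun \<times> bfun \<times> bfun"
  where "step \<nu> r = (\<lambda>(\<mu>, p, q, s). let c = osc_sum \<nu> r (\<mu>, p, q, s) in
    (max 0 (min 1 (\<mu> + 1 - c)), resolvent \<nu> (rhs1 (\<nu>\<^sup>2) r \<mu> p q),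
      resolvent \<nu> (rhs3 (\<nu>\<^sup>2) r \<mu> p q s) /\<^sub>R c, resolvent \<nu> (rhs4 (\<nu>\<^sup>2) \<mu> q s) /\<^sub>R c))"

text \<open>Mean zero and monotonicity force f 0 \<le> 0 \<le> f pi.\<close>

lemma zero_mean_incr_bound:
  assumes "incr f" "Int_pi f = 0" "t \<in> {0..pi}"
  shows "\<bar>apply_bcontfun f t\<bar> \<le> osc f"
proof -
  have "integral {0..pi} (\<lambda>t. apply_bcontfun f 0) \<le> Int_pi f" "Int_pi f \<le> integral {0..pi} (\<lambda>t. apply_bcontfun f pi)"
    unfolding Int_pi_def using assms(1)
    by (intro integral_le integrable_bfun integrable_continuous_real continuous_on_const; auto intro: mono_onD)+
  then have "f 0 \<le> 0" "0 \<le> f pi" using assms(2) mult_le_cancel_left_pos[OF pi_gt_zero, of "f 0" 0] mult_le_cancel_left_pos[OF pi_gt_zero, of 0 "f pi"] by auto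
  moreover have "f 0 \<le> f t" "f t \<le> f pi" using assms(1,3) by (auto intro: mono_onD)
  ultimately show ?thesis by (simp add: osc_def)
qed

lemma Int_pi_mono:
  assumes "\<And>t. t \<in> {0..pi} \<Longrightarrow> apply_bcontfun f t \<le> apply_bcontfun g t"
  shows "Int_pi f \<le> Int_pi g"
  unfolding Int_pi_def using assms by (intro integral_le) auto

lemma Int_pi_const [simp]: "Int_pi (const_bcontfun c) = pi * c"
  by (simp add: Int_pi_def const_bcontfun.rep_eq)

section \<open>Invariance of the state set\<close>

context
  fixes \<nu> R r L :: real
  assumes \<nu>: "0 < \<nu>" and R: "4 * R < \<nu>\<^sup>2" and r: "0 \<le> r" "r \<le> R" and L: "2 * (1 + \<nu>\<^sup>2) * pi \<le> L"
begin

context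
  fixes \<mu> :: real and p q s :: bfun
  assumes z: "(\<mu>, p, q, s) \<in> states L"
begin

lemma state_facts:
  "0 \<le> \<mu>" "\<mu> \<le> 1" "p \<in> lip_funs L" "incr p" "0 \<le> apply_bcontfun p 0" "Int_pi p = 1"
  "q \<in> lip_funs L" "incr q" "Int_pi q = 0" "s \<in> lip_funs L" "incr s" "Int_pi s = 0" "osc q + osc s = 1"
  using z by (auto simp: states_def P_set_def QS_set_def Q_set_def)

lemma p_nonneg: "t \<in> {0..pi} \<Longrightarrow> 0 \<le> apply_bcontfun p t"
  using state_facts(4,5) mono_onD[of "{0..pi}" p 0 t] by auto

lemma osc_nonneg: "0 \<le> osc q" "0 \<le> osc s"
  using state_facts(8,11) by (auto simp: osc_def intro: mono_onD)

lemma q_bound: "t \<in> {0..pi} \<Longrightarrow> \<bar>apply_bcontfun q t\<bar> \<le> 1"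
  using zero_mean_incr_bound[of q t] state_facts osc_nonneg by auto

text \<open>As p is nonnegative with integral 1, this integral is a weighted average of q.\<close>

lemma mean_bound: "\<bar>Int_pi (bmult q p)\<bar> \<le> 1"
proof -
  have "Int_pi (bmult q p) \<le> Int_pi p"
    by (intro Int_pi_mono) (use p_nonneg q_bound mult_right_mono[of "q _" 1 "p _"] in fastforce)
  moreover have "Int_pi (- p) \<le> Int_pi (bmult q p)"
    by (intro Int_pi_mono) (use p_nonneg q_bound mult_right_mono[of "-1" "q _" "p _"] in fastforce)
  ultimately show ?thesis using state_facts(6) by (simp add: Int_pi_simps)
qed

lemma apply_shift_mean: "apply_bcontfun (shift_mean p q) t = Int_pi (bmult q p) - q t"
  by (simp add: shift_mean_def const_bcontfun.rep_eq)

lemma shift_mean_bound: "t \<in> {0..pi} \<Longrightarrow> \<bar>apply_bcontfun (shift_mean p q) t\<bar> \<le> 2"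
  using q_bound[of t] mean_bound by (simp add: apply_shift_mean)

lemma Int_shift_mean_p: "Int_pi (bmult (shift_mean p q) p) = 0"
proof -
  have "bmult (shift_mean p q) p = Int_pi (bmult q p) *\<^sub>R p - bmult q p"
    by (intro bcontfun_eqI) (simp add: apply_shift_mean algebra_simps)
  then show ?thesis using state_facts(6) by (simp add: Int_pi_simps)
qed

text \<open>Expand the square of p - 1/pi. The bound keeps the denominator of \<open>amp2\<close>
  away from 0.\<close>

lemma Int_pp: "1 / pi \<le> Int_pi (bmult p p)"
proof -
  have "0 \<le> Int_pi (bmult (p - const_bcontfun (1 / pi)) (p - const_bcontfun (1 / pi)))"
    using Int_pi_mono[of 0] by (simp add: linear_0[OF Int_pi_linear])
  also have "bmult (p - const_bcontfun (1 / pi)) (p - const_bcontfun (1 / pi))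
      = bmult p p - (2 / pi) *\<^sub>R p + const_bcontfun (1 / pi\<^sup>2)"
    by (intro bcontfun_eqI) (simp add: const_bcontfun.rep_eq algebra_simps power2_eq_square)
  finally show ?thesis using state_facts(6) by (simp add: Int_pi_simps power2_eq_square)
qed

lemma Int_pp_pos: "0 < Int_pi (bmult p p)"
  using Int_pp by (rule less_le_trans[rotated]) simp

lemma amp2_nonneg: "0 \<le> amp2 p q"
  using Int_pp_pos Int_pi_mono[of 0 "bmult (shift_mean p q) (shift_mean p q)"]
  unfolding amp2_def by (intro divide_nonneg_pos) (auto simp: linear_0[OF Int_pi_linear])

lemma Int_quad: "Int_pi (quad p q) = 0"
  using Int_pp_pos by (simp add: quad_def Int_pi_simps amp2_def)

lemma mu_r: "0 \<le> \<mu> * r" "\<mu> * r \<le> R"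
  using state_facts(1,2) r mult_mono[of \<mu> 1 r R] by auto

lemma apply_rhs1: "apply_bcontfun (rhs1 (\<nu>\<^sup>2) r \<mu> p q) t = (\<nu>\<^sup>2 - 2 * \<mu> * r * shift_mean p q t) * p t"
  by (simp add: rhs1_def algebra_simps)

text \<open>The shifted mean is at most 2 in absolute value, so the subtracted term is at most 4 R;
  the condition 4 R < \<nu>^2 makes the shift large enough.\<close>

lemma factor_nonneg:
  assumes t: "t \<in> {0..pi}"
  shows "0 \<le> \<nu>\<^sup>2 - 2 * \<mu> * r * shift_mean p q t"
proof -
  have "\<mu> * r * shift_mean p q t \<le> R * 2"
    using shift_mean_bound[OF t] mu_r by (intro order_trans[OF mult_left_mono[of _ 2] mult_right_mono]) auto
  then show ?thesis using R by (simp add: mult.assoc)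
qed

lemma rhs1_nonneg: "t \<in> {0..pi} \<Longrightarrow> 0 \<le> apply_bcontfun (rhs1 (\<nu>\<^sup>2) r \<mu> p q) t"
  unfolding apply_rhs1 by (intro mult_nonneg_nonneg factor_nonneg p_nonneg)

text \<open>A product of nonnegative increasing functions: the first factor increases because
  \<open>shift_mean p q\<close> decreases.\<close>

lemma incr_rhs1: "incr (rhs1 (\<nu>\<^sup>2) r \<mu> p q)"
proof (rule mono_onI)
  fix x y :: real assume xy: "x \<in> {0..pi}" "y \<in> {0..pi}" "x \<le> y"
  have "q x \<le> q y" "p x \<le> p y" using state_facts(4,8) xy by (auto intro: mono_onD)
  then have "\<nu>\<^sup>2 - 2 * \<mu> * r * shift_mean p q x \<le> \<nu>\<^sup>2 - 2 * \<mu> * r * shift_mean p q y"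
    using mult_left_mono[OF _ mu_r(1), of "shift_mean p q y" "shift_mean p q x"]
    by (simp add: apply_shift_mean mult.assoc)
  then show "rhs1 (\<nu>\<^sup>2) r \<mu> p q x \<le> rhs1 (\<nu>\<^sup>2) r \<mu> p q y"
    unfolding apply_rhs1 using factor_nonneg xy p_nonneg \<open>p x \<le> p y\<close> by (intro mult_mono) auto
qed

lemma Int_rhs1: "Int_pi (rhs1 (\<nu>\<^sup>2) r \<mu> p q) = \<nu>\<^sup>2"
  using state_facts(6) by (simp add: rhs1_def Int_pi_simps Int_shift_mean_p)

lemma step1_in: "resolvent \<nu> (rhs1 (\<nu>\<^sup>2) r \<mu> p q) \<in> P_set L"
proof -
  define F where "F = rhs1 (\<nu>\<^sup>2) r \<mu> p q"
  have I: "Int_pi (resolvent \<nu> F) = 1"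
    using Int_pi_resolvent[OF \<nu>, of F] Int_rhs1 \<nu> by (simp add: F_def)
  have inc: "incr (resolvent \<nu> F)" by (intro incr_resolvent \<nu>) (simp add: F_def incr_rhs1)
  have 0: "0 \<le> resolvent \<nu> F 0"
    by (simp add: apply_resolvent_Icc \<nu>, intro res_nonneg \<nu>) (auto simp: F_def intro: rhs1_nonneg)
  have "Int_pi (const_bcontfun (resolvent \<nu> F 0)) \<le> Int_pi (resolvent \<nu> F)"
    by (intro Int_pi_mono) (use inc in \<open>auto simp: const_bcontfun.rep_eq intro: mono_onD\<close>)
  then have "pi * resolvent \<nu> F 0 \<le> 1" using I by simp
  then have 1: "resolvent \<nu> F 0 \<le> 1" using 0 pi_ge_two mult_right_mono[of 1 pi "resolvent \<nu> F 0"] by simp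
  \<comment> \<open>The right hand side is nonnegative, so its L1 norm is its integral \<nu>^2,
    which is below L.\<close>
  have der: "\<bar>res' \<nu> F x\<bar> \<le> L" if "x \<in> {0..pi}" for x
  proof -
    have "\<bar>res' \<nu> F x\<bar> \<le> integral {0..pi} (\<lambda>s. \<bar>F s\<bar>)" by (intro res'_bound \<nu> that) simp
    also have "\<dots> = Int_pi F"
      unfolding Int_pi_def by (intro integral_cong) (auto simp: F_def intro!: abs_of_nonneg rhs1_nonneg)
    also have "\<dots> \<le> L"
    proof -
      have "\<nu>\<^sup>2 \<le> (1 + \<nu>\<^sup>2) * 2" by (simp add: algebra_simps)
      also have "\<dots> \<le> (1 + \<nu>\<^sup>2) * (2 * pi)" using pi_ge_two by (intro mult_left_mono) auto
      finally show ?thesis using L Int_rhs1 by (simp add: F_def mult_ac)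
    qed
    finally show ?thesis .
  qed
  have "\<bar>resolvent \<nu> F s - resolvent \<nu> F t\<bar> \<le> L * \<bar>tri s - tri t\<bar>" for s t
    unfolding apply_resolvent[OF \<nu>] by (intro res_lipschitz \<nu> der tri_in) auto
  then show ?thesis using I inc 0 1 by (simp add: P_set_def lip_funs_def F_def)
qed

text \<open>The only term that can decrease is minus the square of the shifted mean. Its drop is at
  most 4 times the growth of q, as the shifted mean is bounded by 2, so 4 R q compensates for
  it.\<close>

lemma incr_rhs3_part: "incr ((4 * R) *\<^sub>R q + (\<mu> * r) *\<^sub>R quad p q)"
proof (rule mono_onI)
  fix x y :: real assume xy: "x \<in> {0..pi}" "y \<in> {0..pi}" "x \<le> y"
  have q: "q x \<le> q y" and "p x \<le> p y" using state_facts(4,8) xy by (auto intro: mono_onD)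
  then have "(p x)\<^sup>2 \<le> (p y)\<^sup>2" using p_nonneg[OF xy(1)] by (intro power_mono)
  then have 1: "\<mu> * r * (amp2 p q * (p x)\<^sup>2) \<le> \<mu> * r * (amp2 p q * (p y)\<^sup>2)"
    by (intro mult_left_mono amp2_nonneg mu_r)
  define X Y where "X = shift_mean p q x" and "Y = shift_mean p q y"
  have "Y\<^sup>2 - X\<^sup>2 = (q y - q x) * - (X + Y)"
    by (simp add: X_def Y_def apply_shift_mean power2_eq_square algebra_simps)
  also have "\<dots> \<le> (q y - q x) * 4"
    using q shift_mean_bound[OF xy(1)] shift_mean_bound[OF xy(2)] by (intro mult_left_mono) (auto simp: X_def Y_def)
  finally have "\<mu> * r * (Y\<^sup>2 - X\<^sup>2) \<le> \<mu> * r * ((q y - q x) * 4)" by (intro mult_left_mono mu_r)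
  also have "\<dots> \<le> R * ((q y - q x) * 4)" using q by (intro mult_right_mono mu_r) auto
  finally have "\<mu> * r * (Y\<^sup>2 - X\<^sup>2) \<le> 4 * R * (q y - q x)" by (simp add: algebra_simps)
  with 1 show "((4 * R) *\<^sub>R q + (\<mu> * r) *\<^sub>R quad p q) x \<le> ((4 * R) *\<^sub>R q + (\<mu> * r) *\<^sub>R quad p q) y"
    by (simp add: quad_def X_def Y_def power2_eq_square algebra_simps)
qed

lemma rhs3_split: "rhs3 (\<nu>\<^sup>2) r \<mu> p q s
    = ((4 * R) *\<^sub>R q + (\<mu> * r) *\<^sub>R quad p q) + ((\<nu>\<^sup>2 - 4 * R + \<mu>) *\<^sub>R q + \<mu> *\<^sub>R s)"
  by (simp add: rhs3_def algebra_simps)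

lemma incr_rhs3: "incr (rhs3 (\<nu>\<^sup>2) r \<mu> p q s)"
proof -
  have "incr ((\<nu>\<^sup>2 - 4 * R + \<mu>) *\<^sub>R q + \<mu> *\<^sub>R s)"
    using state_facts R by (auto simp: mono_on_def intro!: add_mono mult_left_mono)
  with incr_rhs3_part show ?thesis
    unfolding rhs3_split by (simp add: mono_on_def add_mono)
qed

lemma incr_rhs4: "incr (rhs4 (\<nu>\<^sup>2) \<mu> q s)"
  using state_facts by (auto simp: rhs4_def mono_on_def intro!: add_mono mult_left_mono)

lemma Int_rhs3: "Int_pi (rhs3 (\<nu>\<^sup>2) r \<mu> p q s) = 0"
  using state_facts by (simp add: rhs3_def Int_pi_simps Int_quad)

lemma Int_rhs4: "Int_pi (rhs4 (\<nu>\<^sup>2) \<mu> q s) = 0"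
  using state_facts by (simp add: rhs4_def Int_pi_simps)

text \<open>The nonlinearity, compensated by 4 R q, is increasing and has a nonnegative cosine
  coefficient. Dropping it leaves a linear estimate that holds for every r in [0, R].\<close>

lemma ocos_rhs3: "(\<nu>\<^sup>2 - 4 * R + \<mu>) * ocos q + \<mu> * ocos s \<le> ocos (rhs3 (\<nu>\<^sup>2) r \<mu> p q s)"
  unfolding rhs3_split using ocos_nonneg[OF incr_rhs3_part] by (simp only: ocos_add ocos_scaleR)

lemma ocos_rhs4: "ocos (rhs4 (\<nu>\<^sup>2) \<mu> q s) = (\<nu>\<^sup>2 + \<mu>) * ocos s + \<mu> * ocos q"
  by (simp only: rhs4_def ocos_add ocos_scaleR)

lemma ocos_nonneg_qs: "0 \<le> ocos q" "0 \<le> ocos s"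
  using state_facts by (auto intro: ocos_nonneg)

lemma not_both_zero: "\<not> (ocos q = 0 \<and> ocos s = 0)"
  using ocos_eq_0[of q] ocos_eq_0[of s] state_facts by auto

abbreviation \<kappa> where "\<kappa> \<equiv> osc_sum \<nu> r (\<mu>, p, q, s)"

lemma osc_parts_nonneg:
  "0 \<le> osc (resolvent \<nu> (rhs3 (\<nu>\<^sup>2) r \<mu> p q s))" "0 \<le> osc (resolvent \<nu> (rhs4 (\<nu>\<^sup>2) \<mu> q s))"
  using incr_resolvent[OF \<nu> incr_rhs3] incr_resolvent[OF \<nu> incr_rhs4] by (auto simp: osc_def intro: mono_onD)

text \<open>Makes the division in \<open>step\<close> legitimate. If both oscillations vanished, so
  would the cosine coefficients of the right hand sides, hence those of q and s, and both would be
  constant on [0, pi] against the normalisation.\<close>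

lemma osc_sum_pos: "0 < \<kappa>"
proof (rule ccontr)
  assume "\<not> 0 < \<kappa>"
  then have 0: "osc (resolvent \<nu> (rhs3 (\<nu>\<^sup>2) r \<mu> p q s)) = 0" "osc (resolvent \<nu> (rhs4 (\<nu>\<^sup>2) \<mu> q s)) = 0"
    using osc_parts_nonneg by (auto simp: osc_sum_def)
  have z0: "ocos f \<le> 0" if "incr f" "osc (resolvent \<nu> f) = 0" for f
  proof -
    have "ocos (resolvent \<nu> f) \<le> pi * osc (resolvent \<nu> f)"
      unfolding osc_def by (intro osc_cos_le_osc incr_resolvent \<nu> that) auto
    then have "ocos (resolvent \<nu> f) \<le> 0" using that by simp
    then have "(1 + \<nu>\<^sup>2) * ocos (resolvent \<nu> f) \<le> 0" by (simp add: mult_nonneg_nonpos add_nonneg_nonneg)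
    then show ?thesis by (simp only: ocos_resolvent[OF \<nu>])
  qed
  have mu: "0 \<le> \<mu> * ocos q" "0 \<le> \<mu> * ocos s"
    using state_facts ocos_nonneg_qs by (auto intro: mult_nonneg_nonneg)
  have "(\<nu>\<^sup>2 - 4 * R) * ocos q \<le> 0"
    using ocos_rhs3 z0[OF incr_rhs3 0(1)] mu by (simp add: algebra_simps)
  then have "ocos q = 0" using R ocos_nonneg_qs(1) by (simp add: mult_le_0_iff)
  moreover have "\<nu>\<^sup>2 * ocos s \<le> 0"
    using ocos_rhs4 z0[OF incr_rhs4 0(2)] mu by (simp add: algebra_simps)
  then have "ocos s = 0" using \<nu> ocos_nonneg_qs(2) by (simp add: mult_le_0_iff)
  ultimately show False using not_both_zero by simp
qed

text \<open>However small \<kappa> is, dividing by it keeps the Lipschitz constant L, because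
  \<open>res'_le_osc\<close> bounds the slope by the oscillation, which is at most \<kappa>.\<close>

lemma scaled_in_Q:
  assumes f: "incr f" "Int_pi f = 0" and le: "osc (resolvent \<nu> f) \<le> \<kappa>"
  shows "resolvent \<nu> f /\<^sub>R \<kappa> \<in> Q_set L"
proof -
  have I: "Int_pi (resolvent \<nu> f) = 0" using Int_pi_resolvent[OF \<nu>, of f] f \<nu> by simp
  have inc: "incr (resolvent \<nu> f)" by (intro incr_resolvent \<nu> f)
  have der: "\<bar>res' \<nu> f x\<bar> \<le> L * \<kappa>" if x: "x \<in> {0..pi}" for x
  proof -
    have "\<bar>res' \<nu> f x\<bar> \<le> 2 * (1 + \<nu>\<^sup>2) * pi * osc (resolvent \<nu> f)"
      using res'_le_osc[OF \<nu> _ f(1) x] by (simp add: osc_def apply_resolvent_Icc[OF \<nu>])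
    also have "\<dots> \<le> L * \<kappa>"
      using L le inc osc_sum_pos by (intro mult_mono) (auto simp: osc_def intro: mono_onD order_trans[OF _ L])
    finally show ?thesis .
  qed
  have lip: "\<bar>resolvent \<nu> f s - resolvent \<nu> f t\<bar> \<le> L * \<kappa> * \<bar>tri s - tri t\<bar>" for s t
    unfolding apply_resolvent[OF \<nu>] by (intro res_lipschitz \<nu> der tri_in) auto
  have "\<bar>resolvent \<nu> f s / \<kappa> - resolvent \<nu> f t / \<kappa>\<bar> \<le> L * \<bar>tri s - tri t\<bar>" for s t
    using lip[of s t] osc_sum_pos by (simp add: abs_divide field_simps flip: diff_divide_distrib)
  moreover have "\<bar>resolvent \<nu> f 0\<bar> \<le> \<kappa>"
    using zero_mean_incr_bound[OF inc I, of 0] le by simp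
  moreover have "apply_bcontfun (resolvent \<nu> f /\<^sub>R \<kappa>) t = resolvent \<nu> f t / \<kappa>" for t
    by (simp add: divide_inverse mult.commute)
  moreover have "Int_pi (resolvent \<nu> f /\<^sub>R \<kappa>) = 0" by (simp only: Int_pi_simps I mult_zero_right real_scaleR_def)
  moreover have "mono_on {0..pi} (\<lambda>t. resolvent \<nu> f t / \<kappa>)"
    using inc osc_sum_pos by (auto simp: mono_on_def intro: divide_right_mono)
  moreover have "\<bar>resolvent \<nu> f 0 / \<kappa>\<bar> \<le> 1"
    using \<open>\<bar>resolvent \<nu> f 0\<bar> \<le> \<kappa>\<close> osc_sum_pos by (simp add: abs_divide)
  ultimately show ?thesis
    by (simp add: Q_set_def lip_funs_def)
qed

lemma step_in: "step \<nu> r (\<mu>, p, q, s) \<in> states L"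
proof -
  have \<kappa>: "\<kappa> = osc (resolvent \<nu> (rhs3 (\<nu>\<^sup>2) r \<mu> p q s)) + osc (resolvent \<nu> (rhs4 (\<nu>\<^sup>2) \<mu> q s))"
    by (simp add: osc_sum_def)
  have "osc (f /\<^sub>R \<kappa>) = osc f / \<kappa>" for f
    by (simp add: osc_def divide_inverse algebra_simps)
  then have "osc (resolvent \<nu> (rhs3 (\<nu>\<^sup>2) r \<mu> p q s) /\<^sub>R \<kappa>) + osc (resolvent \<nu> (rhs4 (\<nu>\<^sup>2) \<mu> q s) /\<^sub>R \<kappa>) = 1"
    using osc_sum_pos \<kappa> by (simp flip: add_divide_distrib)
  moreover have "resolvent \<nu> (rhs3 (\<nu>\<^sup>2) r \<mu> p q s) /\<^sub>R \<kappa> \<in> Q_set L"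
    by (intro scaled_in_Q incr_rhs3 Int_rhs3) (use \<kappa> osc_parts_nonneg in simp)
  moreover have "resolvent \<nu> (rhs4 (\<nu>\<^sup>2) \<mu> q s) /\<^sub>R \<kappa> \<in> Q_set L"
    by (intro scaled_in_Q incr_rhs4 Int_rhs4) (use \<kappa> osc_parts_nonneg in simp)
  ultimately show ?thesis
    using step1_in by (simp add: step_def states_def QS_set_def Let_def)
qed

section \<open>A priori information at fixed points\<close>

context
  assumes fixed: "step \<nu> r (\<mu>, p, q, s) = (\<mu>, p, q, s)"
begin

lemma fixed_eqs:
  "max 0 (min 1 (\<mu> + 1 - \<kappa>)) = \<mu>" "resolvent \<nu> (rhs1 (\<nu>\<^sup>2) r \<mu> p q) = p"
  "resolvent \<nu> (rhs3 (\<nu>\<^sup>2) r \<mu> p q s) = \<kappa> *\<^sub>R q" "resolvent \<nu> (rhs4 (\<nu>\<^sup>2) \<mu> q s) = \<kappa> *\<^sub>R s"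
proof -
  have "resolvent \<nu> (rhs3 (\<nu>\<^sup>2) r \<mu> p q s) /\<^sub>R \<kappa> = q" "resolvent \<nu> (rhs4 (\<nu>\<^sup>2) \<mu> q s) /\<^sub>R \<kappa> = s"
    using fixed by (simp_all add: step_def Let_def)
  then show "resolvent \<nu> (rhs3 (\<nu>\<^sup>2) r \<mu> p q s) = \<kappa> *\<^sub>R q" "resolvent \<nu> (rhs4 (\<nu>\<^sup>2) \<mu> q s) = \<kappa> *\<^sub>R s"
    using osc_sum_pos by (metis divideR_right less_irrefl)+
  show "max 0 (min 1 (\<mu> + 1 - \<kappa>)) = \<mu>" "resolvent \<nu> (rhs1 (\<nu>\<^sup>2) r \<mu> p q) = p"
    using fixed by (simp_all add: step_def Let_def)
qed

lemma eigen3: "(1 + \<nu>\<^sup>2) * (\<kappa> * ocos q) = ocos (rhs3 (\<nu>\<^sup>2) r \<mu> p q s)"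
  using ocos_resolvent[OF \<nu>, of "rhs3 (\<nu>\<^sup>2) r \<mu> p q s"] by (simp only: fixed_eqs ocos_scaleR)

lemma eigen4: "(1 + \<nu>\<^sup>2) * (\<kappa> * ocos s) = (\<nu>\<^sup>2 + \<mu>) * ocos s + \<mu> * ocos q"
  using ocos_resolvent[OF \<nu>, of "rhs4 (\<nu>\<^sup>2) \<mu> q s"] by (simp only: fixed_eqs ocos_scaleR ocos_rhs4)

text \<open>If \<mu> is truncated at 0 then \<kappa> is at least 1. But at \<mu> = 0 the tested
  equations multiply both cosine coefficients by \<nu>^2 / (1 + \<nu>^2) < 1, so both would
  vanish.\<close>

lemma mu_pos: "0 < \<mu>"
proof (rule ccontr)
  assume "\<not> 0 < \<mu>"
  then have m0: "\<mu> = 0" using state_facts by simp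
  then have "1 \<le> \<kappa>" using fixed_eqs(1) by auto
  have *: "x = 0" if "(1 + \<nu>\<^sup>2) * (\<kappa> * x) = \<nu>\<^sup>2 * x" "0 \<le> x" for x
  proof -
    have "x \<le> \<kappa> * x" using \<open>1 \<le> \<kappa>\<close> that(2) mult_right_mono[of 1 \<kappa> x] by simp
    then have "(1 + \<nu>\<^sup>2) * x \<le> \<nu>\<^sup>2 * x" unfolding that(1)[symmetric] by (intro mult_left_mono) auto
    then show ?thesis using that(2) by (simp add: algebra_simps)
  qed
  have "ocos s = 0" by (rule *) (use eigen4 m0 ocos_nonneg_qs in auto)
  moreover have "ocos q = 0"
  proof (rule *)
    have "rhs3 (\<nu>\<^sup>2) r \<mu> p q s = \<nu>\<^sup>2 *\<^sub>R q" by (simp add: rhs3_def m0)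
    then show "(1 + \<nu>\<^sup>2) * (\<kappa> * ocos q) = \<nu>\<^sup>2 * ocos q" using eigen3 by (simp only: ocos_scaleR)
  qed (rule ocos_nonneg_qs)
  ultimately show False using not_both_zero by simp
qed

text \<open>If \<mu> is truncated at 1 then \<kappa> is at most 1. The s equation then leaves no
  room for the coefficient of q, and with that coefficient zero the q equation leaves none for
  s.\<close>

lemma mu_less_1: "\<mu> < 1"
proof (rule ccontr)
  assume "\<not> \<mu> < 1"
  then have m1: "\<mu> = 1" using state_facts by simp
  then have c1: "\<kappa> \<le> 1" using fixed_eqs(1) by auto
  have le: "(1 + \<nu>\<^sup>2) * (\<kappa> * x) \<le> (1 + \<nu>\<^sup>2) * x" if "0 \<le> x" for x
    using c1 that mult_right_mono[of \<kappa> 1 x] by (intro mult_left_mono) (auto simp: add_nonneg_nonneg)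
  have "ocos q \<le> 0" using eigen4 le[OF ocos_nonneg_qs(2)] unfolding m1 by (simp add: algebra_simps)
  then have q0: "ocos q = 0" using ocos_nonneg_qs by simp
  then have "ocos s \<le> 0" using ocos_rhs3 eigen3 m1 by simp
  then show False using q0 ocos_nonneg_qs not_both_zero by simp
qed

lemma osc_sum_eq_1: "\<kappa> = 1"
  using fixed_eqs(1) mu_pos mu_less_1 by auto

text \<open>At r = 0 the tested equations are linear and symmetric in q and s. The two coefficients
  agree and are nonzero, whence 1 - \<mu> = \<mu>.\<close>

lemma mu_eq_half: "r = 0 \<Longrightarrow> \<mu> = 1/2"
proof -
  assume r0: "r = 0"
  have 3: "(1 - \<mu>) * ocos q = \<mu> * ocos s"
  proof -
    have "rhs3 (\<nu>\<^sup>2) r \<mu> p q s = (\<nu>\<^sup>2 + \<mu>) *\<^sub>R q + \<mu> *\<^sub>R s" by (simp add: rhs3_def r0 algebra_simps)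
    then have "(1 + \<nu>\<^sup>2) * (1 * ocos q) = (\<nu>\<^sup>2 + \<mu>) * ocos q + \<mu> * ocos s"
      using eigen3 by (simp only: osc_sum_eq_1 ocos_add ocos_scaleR)
    then show ?thesis by (simp add: algebra_simps)
  qed
  have 4: "(1 - \<mu>) * ocos s = \<mu> * ocos q"
    using eigen4 by (simp add: osc_sum_eq_1 algebra_simps)
  have "ocos q = ocos s" using 3 4 by (simp add: algebra_simps)
  then have "ocos q \<noteq> 0" using not_both_zero by auto
  then show ?thesis using 3 \<open>ocos q = ocos s\<close> by simp
qed

end

end

end

section \<open>Continuity of the map and nonemptiness of the state set\<close>

lemma continuous_on_shift_mean [continuous_intros]:
  "continuous_on S f \<Longrightarrow> continuous_on S g \<Longrightarrow> continuous_on S (\<lambda>x. shift_mean (f x) (g x))"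
  unfolding shift_mean_def by (intro continuous_intros)

lemma continuous_on_amp2 [continuous_intros]:
  assumes "continuous_on S f" "continuous_on S g" "\<And>x. x \<in> S \<Longrightarrow> Int_pi (bmult (f x) (f x)) \<noteq> 0"
  shows "continuous_on S (\<lambda>x. amp2 (f x) (g x))"
  unfolding amp2_def using assms by (intro continuous_intros) auto

lemma continuous_on_step:
  assumes \<nu>: "0 < \<nu>" and R: "0 \<le> R" "4 * R < \<nu>\<^sup>2" and L: "2 * (1 + \<nu>\<^sup>2) * pi \<le> L"
  shows "continuous_on ({0..R} \<times> states L) (\<lambda>(r, z). step \<nu> r z)"
proof -
  define D where "D = {0..R} \<times> states L"
  have [continuous_intros]: "continuous_on S f \<Longrightarrow> continuous_on S (\<lambda>x. resolvent \<nu> (f x))"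
    for S :: "(real \<times> real \<times> bfun \<times> bfun \<times> bfun) set" and f
    by (rule bounded_linear.continuous_on[OF bounded_linear_resolvent[OF \<nu>]])
  define r \<mu> p q s where defs: "r = (\<lambda>z :: real \<times> real \<times> bfun \<times> bfun \<times> bfun. fst z)"
    "\<mu> = (\<lambda>z :: real \<times> real \<times> bfun \<times> bfun \<times> bfun. fst (snd z))"
    "p = (\<lambda>z :: real \<times> real \<times> bfun \<times> bfun \<times> bfun. fst (snd (snd z)))"
    "q = (\<lambda>z :: real \<times> real \<times> bfun \<times> bfun \<times> bfun. fst (snd (snd (snd z))))"
    "s = (\<lambda>z :: real \<times> real \<times> bfun \<times> bfun \<times> bfun. snd (snd (snd (snd z))))"
  have c: "continuous_on D r" "continuous_on D \<mu>" "continuous_on D p" "continuous_on D q" "continuous_on D s"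
    unfolding defs by (intro continuous_intros)+
  have st: "(\<mu> z, p z, q z, s z) \<in> states L" "0 \<le> r z" "r z \<le> R" if "z \<in> D" for z
    using that by (auto simp: D_def defs)
  have c1: "continuous_on D (\<lambda>z. shift_mean (p z) (q z))"
    by (intro continuous_intros c)
  have "Int_pi (bmult (p z) (p z)) \<noteq> 0" if "z \<in> D" for z
    using Int_pp_pos[OF \<nu> R(2) st(2,3)[OF that] L st(1)[OF that]] by simp
  then have c2: "continuous_on D (\<lambda>z. amp2 (p z) (q z))"
    by (intro continuous_intros c)
  have c3: "continuous_on D (\<lambda>z. quad (p z) (q z))"
    unfolding quad_def by (intro continuous_intros c c1 c2)
  have r1: "continuous_on D (\<lambda>z. resolvent \<nu> (rhs1 (\<nu>\<^sup>2) (r z) (\<mu> z) (p z) (q z)))"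
    unfolding rhs1_def by (intro continuous_intros c c1)
  have r3: "continuous_on D (\<lambda>z. resolvent \<nu> (rhs3 (\<nu>\<^sup>2) (r z) (\<mu> z) (p z) (q z) (s z)))"
    unfolding rhs3_def by (intro continuous_intros c c3)
  have r4: "continuous_on D (\<lambda>z. resolvent \<nu> (rhs4 (\<nu>\<^sup>2) (\<mu> z) (q z) (s z)))"
    unfolding rhs4_def by (intro continuous_intros c)
  have co: "continuous_on D (\<lambda>z. osc_sum \<nu> (r z) (\<mu> z, p z, q z, s z))"
    unfolding osc_sum_def prod.case by (intro continuous_intros r3 r4)
  have "osc_sum \<nu> (r z) (\<mu> z, p z, q z, s z) \<noteq> 0" if "z \<in> D" for z
    using osc_sum_pos[OF \<nu> R(2) st(2,3)[OF that] L st(1)[OF that]] by simp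
  then have "continuous_on D (\<lambda>z. step \<nu> (r z) (\<mu> z, p z, q z, s z))"
    unfolding step_def prod.case Let_def by (intro continuous_intros c co r1 r3 r4) auto
  then show ?thesis
    by (simp add: D_def defs case_prod_unfold)
qed

lemma states_nonempty:
  assumes L: "1 \<le> L"
  shows "states L \<noteq> {}"
proof -
  \<comment> \<open>This function has mean zero and oscillation 1, so (q, 0) satisfies the
    normalisation.\<close>
  define q :: bfun where "q = Bcontfun (\<lambda>t. - cos t / 2)"
  have q: "apply_bcontfun q t = - cos t / 2" for t
    unfolding q_def by (subst apply_Bcontfun[where B = 1]) (auto intro!: continuous_intros intro: order_trans[OF abs_cos_le_one])
  have lip: "\<bar>cos x - cos y\<bar> \<le> \<bar>x - y\<bar>" for x y :: real
  proof (induction x y rule: linorder_wlog)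
    case (le x y)
    have "\<exists>z\<in>{x..y}. cos y - cos x = - sin z * (y - x)"
      by (rule mvt_very_simple[OF le]) (auto intro!: derivative_eq_intros)
    then obtain z where "cos y - cos x = - sin z * (y - x)" by blast
    then have "\<bar>cos y - cos x\<bar> = \<bar>sin z\<bar> * \<bar>y - x\<bar>" by (simp add: abs_mult)
    then show ?case using mult_right_mono[OF abs_sin_le_one, of "\<bar>y - x\<bar>" z] by (simp add: abs_minus_commute)
  qed (simp add: abs_minus_commute)
  have "\<bar>q x - q y\<bar> \<le> L * \<bar>tri x - tri y\<bar>" for x y
  proof -
    have "\<bar>cos x - cos y\<bar> \<le> \<bar>tri x - tri y\<bar>" using lip[of "tri x" "tri y"] by simp
    also have "\<dots> \<le> L * \<bar>tri x - tri y\<bar>" using L mult_right_mono[of 1 L "\<bar>tri x - tri y\<bar>"] by simp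
    finally show ?thesis unfolding q by linarith
  qed
  moreover have "incr q" by (auto simp: q mono_on_def intro: cos_monotone_0_pi_le)
  moreover have "Int_pi q = 0"
  proof -
    have "apply_bcontfun q = (\<lambda>t. (-1/2) * cos t)" by (intro ext) (simp add: q)
    then show ?thesis by (simp only: Int_pi_def integral_mult_right integral_cos_0_pi mult_zero_right)
  qed
  ultimately have "q \<in> Q_set L" by (simp add: Q_set_def lip_funs_def q)
  moreover have "0 \<in> Q_set L"
    using L by (simp add: Q_set_def lip_funs_def linear_0[OF Int_pi_linear] mono_on_def)
  moreover have "osc q + osc 0 = 1" by (simp add: osc_def q)
  moreover have "const_bcontfun (1 / pi) \<in> P_set L"
    using L pi_ge_two by (auto simp: P_set_def lip_funs_def const_bcontfun.rep_eq mono_on_def)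
  ultimately have "(0, const_bcontfun (1 / pi), q, 0) \<in> states L"
    by (simp add: states_def QS_set_def)
  then show ?thesis by blast
qed

subsection \<open>From fixed points to periodic solutions\<close>

definition resolvent' :: "real \<Rightarrow> bfun \<Rightarrow> real \<Rightarrow> real"
  where "resolvent' \<nu> f t = res' \<nu> f (tri t) * sgn (sin t)"

lemma DERIV_resolvent:
  assumes \<nu>: "0 < \<nu>"
  shows "(apply_bcontfun (resolvent \<nu> f) has_real_derivative resolvent' \<nu> f t) (at t)"
proof -
  have "((\<lambda>t. res \<nu> f (tri t)) has_real_derivative res' \<nu> f (tri t) * sgn (sin t)) (at t)"
    by (rule DERIV_even_extension) (use DERIV_res[OF \<nu>] res'_ends[OF \<nu>] in auto)
  then show ?thesis by (simp add: resolvent'_def apply_resolvent[OF \<nu>, abs_def])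
qed

lemma DERIV_resolvent':
  assumes \<nu>: "0 < \<nu>"
  shows "(resolvent' \<nu> f has_real_derivative \<nu>\<^sup>2 * resolvent \<nu> f t - f (tri t)) (at t)"
proof -
  have "((\<lambda>t. res' \<nu> f (tri t) * sgn (sin t)) has_real_derivative
      (\<lambda>t. \<nu>\<^sup>2 * res \<nu> f t - f t) (tri t)) (at t)"
    by (rule DERIV_odd_extension) (use DERIV_res'[OF \<nu>] res'_ends[OF \<nu>] in auto)
  then show ?thesis by (simp add: resolvent'_def[abs_def] apply_resolvent[OF \<nu>])
qed

lemma grad_potential:
  fixes x :: "real^4"
  shows "grad (\<lambda>x :: real^4. - (x$3) * ((x$1)\<^sup>2 + (x$2)\<^sup>2) + 1/3 * (x$3)^3 + 1/2 * (x$4 - x$3)\<^sup>2) x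
    = (- 2 * (x$1) * (x$3)) *\<^sub>R axis 1 1 + (- 2 * (x$2) * (x$3)) *\<^sub>R axis 2 1
      + ((x$3)\<^sup>2 - ((x$1)\<^sup>2 + (x$2)\<^sup>2) - (x$4 - x$3)) *\<^sub>R axis 3 1 + (x$4 - x$3) *\<^sub>R axis 4 1"
proof (rule grad_eqI, unfold gderiv_def)
  have [derivative_intros]: "((\<lambda>x :: real^4. x$i) has_derivative (\<lambda>h. h$i)) (at x)" for i
    by (rule bounded_linear.has_derivative[OF bounded_linear_vec_nth has_derivative_ident])
  show "((\<lambda>x :: real^4. - (x$3) * ((x$1)\<^sup>2 + (x$2)\<^sup>2) + 1/3 * (x$3)^3 + 1/2 * (x$4 - x$3)\<^sup>2) has_derivative
    (\<lambda>h. h \<bullet> ((- 2 * (x$1) * (x$3)) *\<^sub>R axis 1 1 + (- 2 * (x$2) * (x$3)) *\<^sub>R axis 2 1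
      + ((x$3)\<^sup>2 - ((x$1)\<^sup>2 + (x$2)\<^sup>2) - (x$4 - x$3)) *\<^sub>R axis 3 1 + (x$4 - x$3) *\<^sub>R axis 4 1))) (at x)"
    by (rule derivative_eq_intros refl)+
      (auto simp: fun_eq_iff inner_add_right inner_axis algebra_simps power2_eq_square numeral_eq_Suc)
qed

section \<open>Closed curves built from the three components\<close>

definition curve :: "nat \<Rightarrow> bfun \<Rightarrow> bfun \<Rightarrow> bfun \<Rightarrow> real \<Rightarrow> real^4"
  where "curve k f g h t = f (real k * t) *\<^sub>R axis 1 1 + g (real k * t) *\<^sub>R axis 3 1 + h (real k * t) *\<^sub>R axis 4 1"

lemma curve_nth [simp]:
  "curve k f g h t $ 1 = f (real k * t)" "curve k f g h t $ 2 = 0" "curve k f g h t $ 3 = g (real k * t)"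
  "curve k f g h t $ 4 = h (real k * t)"
  by (simp_all add: curve_def axis_def)

definition loop :: "nat \<Rightarrow> bfun \<Rightarrow> bfun \<Rightarrow> bfun \<Rightarrow> real \<Rightarrow> real^4"
  where "loop k f g h = restrict (curve k f g h) {0..2*pi}"

definition even_periodic :: "bfun \<Rightarrow> bool"
  where "even_periodic f \<longleftrightarrow> (\<forall>t. apply_bcontfun f (tri t) = f t)"

lemma tri_periodic: "tri (real k * (t + 2 * pi)) = tri (real k * t)" for k :: nat
proof (rule tri_cong)
  have "real k * (t + 2 * pi) = real k * t + 2 * real k * pi" by (simp add: algebra_simps)
  then show "cos (real k * (t + 2 * pi)) = cos (real k * t)" by (simp only: cos_add cos_2npi sin_2npi mult_1_right mult_zero_right diff_zero)
qed

lemma curve_periodic: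
  assumes "even_periodic f" "even_periodic g" "even_periodic h"
  shows "curve k f g h (t + 2 * pi) = curve k f g h t"
proof -
  have "apply_bcontfun F (real k * (t + 2 * pi)) = F (real k * t)" if "even_periodic F" for F
    using that tri_periodic[of k t] unfolding even_periodic_def by metis
  then show ?thesis using assms unfolding curve_def by simp
qed

lemma continuous_on_curve: "continuous_on S (curve k f g h)"
  unfolding curve_def[abs_def]
  by (intro continuous_intros continuous_on_compose2[OF continuous_on_apply_bcontfun[of UNIV]]) auto

lemma loop_in_C2pi:
  assumes "even_periodic f" "even_periodic g" "even_periodic h"
  shows "loop k f g h \<in> mspace C2pi"
proof -
  have cont: "continuous_on {0..2*pi} (loop k f g h)"
    by (rule continuous_on_eq[OF continuous_on_curve[of _ k f g h]]) (simp add: loop_def)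
  have "Met_TC.mbounded (loop k f g h ` {0..2*pi})"
    by (intro Met_TC.compactin_imp_mbounded) (simp add: compactin_euclidean_iff compact_continuous_image[OF cont])
  moreover have "loop k f g h 0 = loop k f g h (2 * pi)"
    using curve_periodic[OF assms, of k 0] by (simp add: loop_def)
  ultimately show ?thesis
    using cont by (simp add: C2pi_def loop_def)
qed

text \<open>The times 0 and pi / k are sent to 0 and pi, where an oscillation becomes
  visible.\<close>

lemma loop_not_const:
  assumes "1 \<le> k" "osc g \<noteq> 0 \<or> osc h \<noteq> 0"
  shows "loop k f g h \<notin> range const2pi"
proof
  assume "loop k f g h \<in> range const2pi"
  then obtain x where x: "loop k f g h = const2pi x" by auto
  have in2: "0 \<in> {0..2*pi}" "pi / real k \<in> {0..2*pi}"
    using assms(1) pi_ge_zero by (auto simp: field_simps intro: order_trans[of pi "pi * 2"] mult_mono)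
  have "curve k f g h 0 = x" "curve k f g h (pi / real k) = x"
    using fun_cong[OF x, of 0] fun_cong[OF x, of "pi / real k"] in2 by (simp_all add: loop_def const2pi_def)
  then have "curve k f g h 0 = curve k f g h (pi / real k)" by simp
  then have "g 0 = g pi" "h 0 = h pi"
    using assms(1) curve_nth(3)[of k f g h] curve_nth(4)[of k f g h] 
    by (auto dest: arg_cong[where f = "\<lambda>v. v $ 3"] arg_cong[where f = "\<lambda>v. v $ 4"])
  then show False using assms(2) by (simp add: osc_def)
qed

definition x1_part :: "real \<Rightarrow> bfun \<Rightarrow> bfun \<Rightarrow> bfun"
  where "x1_part r p q = (r * sqrt (amp2 p q)) *\<^sub>R p"

definition x3_part :: "real \<Rightarrow> bfun \<Rightarrow> bfun \<Rightarrow> bfun"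
  where "x3_part r p q = r *\<^sub>R shift_mean p q"

definition x4_part :: "real \<Rightarrow> bfun \<Rightarrow> bfun \<Rightarrow> bfun \<Rightarrow> bfun"
  where "x4_part r p q s = r *\<^sub>R (s + const_bcontfun (Int_pi (bmult q p)))"

text \<open>Speeding up by k multiplies the second derivative by k^2, hence \<lambda> = k sqrt
  \<mu>.\<close>

definition sol :: "nat \<Rightarrow> real \<times> real \<times> bfun \<times> bfun \<times> bfun \<Rightarrow> (real \<Rightarrow> real^4) \<times> real"
  where "sol k = (\<lambda>(r, \<mu>, p, q, s).
    (loop k (x1_part r p q) (x3_part r p q) (x4_part r p q s), real k * sqrt \<mu>))"

locale fixed_state =
  fixes \<nu> R r L \<mu> :: real and p q s :: bfun and k :: nat and U :: "real^4 \<Rightarrow> real"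
  assumes \<nu>: "0 < \<nu>" and R: "4 * R < \<nu>\<^sup>2" and r: "0 \<le> r" "r \<le> R" and L: "2 * (1 + \<nu>\<^sup>2) * pi \<le> L"
    and z: "(\<mu>, p, q, s) \<in> states L" and fixed: "step \<nu> r (\<mu>, p, q, s) = (\<mu>, p, q, s)"
    and k: "1 \<le> k"
    and U: "U = (\<lambda>x. - (x$3) * ((x$1)\<^sup>2 + (x$2)\<^sup>2) + 1/3 * (x$3)^3 + 1/2 * (x$4 - x$3)\<^sup>2)"
begin

lemmas facts = state_facts[OF \<nu> R r L z]
lemmas eqs = fixed_eqs[OF \<nu> R r L z fixed]
lemmas c1 = osc_sum_eq_1[OF \<nu> R r L z fixed]

lemma q_eq: "resolvent \<nu> (rhs3 (\<nu>\<^sup>2) r \<mu> p q s) = q" and s_eq: "resolvent \<nu> (rhs4 (\<nu>\<^sup>2) \<mu> q s) = s"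
  using eqs(3,4) c1 by simp_all

lemma even: "apply_bcontfun p (tri t) = p t" "apply_bcontfun q (tri t) = q t" "apply_bcontfun s (tri t) = s t"
  using facts by (auto intro: lip_funs_tri)

lemma even_shift: "apply_bcontfun (shift_mean p q) (tri t) = shift_mean p q t"
  by (simp add: apply_shift_mean[OF \<nu> R r L z] even)

definition "p' = resolvent' \<nu> (rhs1 (\<nu>\<^sup>2) r \<mu> p q)"
definition "q' = resolvent' \<nu> (rhs3 (\<nu>\<^sup>2) r \<mu> p q s)"
definition "s' = resolvent' \<nu> (rhs4 (\<nu>\<^sup>2) \<mu> q s)"

lemma derivs:
  "(p has_real_derivative p' t) (at t)" "(q has_real_derivative q' t) (at t)" "(s has_real_derivative s' t) (at t)"
  using DERIV_resolvent[OF \<nu>, of "rhs1 (\<nu>\<^sup>2) r \<mu> p q" t] DERIV_resolvent[OF \<nu>, of "rhs3 (\<nu>\<^sup>2) r \<mu> p q s" t]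
    DERIV_resolvent[OF \<nu>, of "rhs4 (\<nu>\<^sup>2) \<mu> q s" t]
  by (simp_all add: eqs(2) q_eq s_eq p'_def q'_def s'_def)

lemma derivs':
  "(p' has_real_derivative 2 * \<mu> * r * shift_mean p q t * p t) (at t)"
  "(q' has_real_derivative - \<mu> * (r * (amp2 p q * (p t)\<^sup>2 - (shift_mean p q t)\<^sup>2) + q t + s t)) (at t)"
  "(s' has_real_derivative - \<mu> * (s t + q t)) (at t)"
proof -
  show "(p' has_real_derivative 2 * \<mu> * r * shift_mean p q t * p t) (at t)"
    unfolding p'_def by (rule DERIV_cong[OF DERIV_resolvent'[OF \<nu>]], simp only: eqs(2))
      (simp add: rhs1_def even even_shift)
  show "(q' has_real_derivative - \<mu> * (r * (amp2 p q * (p t)\<^sup>2 - (shift_mean p q t)\<^sup>2) + q t + s t)) (at t)"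
    unfolding q'_def by (rule DERIV_cong[OF DERIV_resolvent'[OF \<nu>]], simp only: q_eq)
      (simp add: rhs3_def quad_def even even_shift algebra_simps power2_eq_square)
  show "(s' has_real_derivative - \<mu> * (s t + q t)) (at t)"
    unfolding s'_def by (rule DERIV_cong[OF DERIV_resolvent'[OF \<nu>]], simp only: s_eq)
      (simp add: rhs4_def even algebra_simps)
qed

lemma parts_even:
  "even_periodic (x1_part r p q)" "even_periodic (x3_part r p q)" "even_periodic (x4_part r p q s)"
  by (simp_all add: even_periodic_def x1_part_def x3_part_def x4_part_def even even_shift const_bcontfun.rep_eq)

text \<open>The x1 equation is linear in x1, so p may be rescaled by A. The amplitude enters the x3
  equation only through A^2 = r^2 \<open>amp2 p q\<close>.\<close>

lemma solution: "periodic_solution U (real k * sqrt \<mu>) (loop k (x1_part r p q) (x3_part r p q) (x4_part r p q s))"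
  unfolding periodic_solution_def
proof (intro exI conjI allI)
  let ?v = "curve k (x1_part r p q) (x3_part r p q) (x4_part r p q s)"
  define A where "A = r * sqrt (amp2 p q)"
  define b where "b = Int_pi (bmult q p)"
  have A2: "A * A = r * r * amp2 p q"
    using amp2_nonneg[OF \<nu> R r L z] by (simp add: A_def algebra_simps)
  let ?v' = "\<lambda>t. (A * (real k * p' (real k * t))) *\<^sub>R axis 1 1 + (- r * (real k * q' (real k * t))) *\<^sub>R axis 3 1
    + (r * (real k * s' (real k * t))) *\<^sub>R axis 4 1 :: real^4"
  have v: "?v = (\<lambda>t. (A * p (real k * t)) *\<^sub>R axis 1 1 + (r * (b - q (real k * t))) *\<^sub>R axis 3 1 + (r * (s (real k * t) + b)) *\<^sub>R axis 4 1)"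
    by (simp add: fun_eq_iff curve_def x1_part_def x3_part_def x4_part_def apply_shift_mean[OF \<nu> R r L z] A_def b_def const_bcontfun.rep_eq)
  show "loop k (x1_part r p q) (x3_part r p q) (x4_part r p q s) = restrict ?v {0..2*pi}"
    by (simp add: loop_def)
  show "?v (t + 2 * pi) = ?v t" for t by (rule curve_periodic[OF parts_even])
  have chain: "((\<lambda>t. F (real k * t)) has_real_derivative real k * F' (real k * t)) (at t)"
    if "\<And>t. (F has_real_derivative F' t) (at t)" for F F' :: "real \<Rightarrow> real" and t
    by (rule DERIV_cong[OF DERIV_chain2[OF that]]) (auto intro!: derivative_eq_intros)
  have scale: "((\<lambda>t. F t *\<^sub>R e) has_vector_derivative F' *\<^sub>R e) (at t)"
    if "(F has_real_derivative F') (at t)" for F F' t and e :: "real^4"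
    using has_vector_derivative_scaleR[OF that has_vector_derivative_const, of e] by simp
  show "(?v has_vector_derivative ?v' t) (at t)" for t
    unfolding v
    by (intro has_vector_derivative_add scale) 
      (auto intro!: derivative_eq_intros chain derivs)
  show "(?v' has_vector_derivative - ((real k * sqrt \<mu>)\<^sup>2 *\<^sub>R grad U (?v t))) (at t)" for t
  proof -
    let ?T = "real k * t"
    have sq: "(real k * sqrt \<mu>)\<^sup>2 = real k * real k * \<mu>" using facts(1) by (simp add: power2_eq_square algebra_simps)
    have shift: "apply_bcontfun (shift_mean p q) t = b - q t" for t by (simp add: apply_shift_mean[OF \<nu> R r L z] b_def)
    have 1: "- ((real k * sqrt \<mu>)\<^sup>2 *\<^sub>R grad U (?v t)) =
      (A * (real k * (real k * (2 * \<mu> * r * (b - q ?T) * p ?T)))) *\<^sub>R axis 1 1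
      + (- r * (real k * (real k * (- \<mu> * (r * (amp2 p q * (p ?T)\<^sup>2 - (b - q ?T)\<^sup>2) + q ?T + s ?T))))) *\<^sub>R axis 3 1
      + (r * (real k * (real k * (- \<mu> * (s ?T + q ?T))))) *\<^sub>R axis 4 1"
      (is "_ = ?rhs")
    proof -
      have comp: "?v t $ 1 = A * p ?T" "?v t $ 2 = 0" "?v t $ 3 = r * (b - q ?T)" "?v t $ 4 = r * (s ?T + b)"
        unfolding v by (simp_all add: axis_def)
      have "A\<^sup>2 = r * r * amp2 p q" by (simp add: power2_eq_square A2)
      then show ?thesis
        unfolding U grad_potential sq comp
        by (simp add: vec_eq_iff forall_4 axis_def) (simp add: algebra_simps power2_eq_square A2)
    qed
    show ?thesis
      unfolding 1
      by (intro has_vector_derivative_add scale)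
        (auto intro!: derivative_eq_intros chain derivs'[unfolded shift])
  qed
qed

lemma osc_parts: "osc (x3_part r p q) = - r * osc q" "osc (x4_part r p q s) = r * osc s"
  by (simp_all add: osc_def x3_part_def x4_part_def apply_shift_mean[OF \<nu> R r L z] const_bcontfun.rep_eq algebra_simps)

lemma sol_in_NT: "0 < r \<Longrightarrow> sol k (r, \<mu>, p, q, s) \<in> NT U"
proof -
  assume "0 < r"
  then have "osc (x3_part r p q) \<noteq> 0 \<or> osc (x4_part r p q s) \<noteq> 0"
    using facts(13) by (auto simp: osc_parts)
  then show ?thesis
    using loop_in_C2pi[OF parts_even, of k] mu_pos[OF \<nu> R r L z fixed] k solution loop_not_const[OF k]
    by (simp add: sol_def NT_def)
qed

lemma sol_0:
  assumes "r = 0"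
  shows "sol k (r, \<mu>, p, q, s) = (const2pi 0, k / sqrt 2)"
proof -
  have \<mu>: "\<mu> = 1 / 2" using mu_eq_half[OF \<nu> R r L z fixed] assms by simp
  show ?thesis
    unfolding sol_def prod.case assms \<mu>
    by (simp add: loop_def const2pi_def x1_part_def x3_part_def x4_part_def curve_def real_sqrt_divide fun_eq_iff)
qed

end

subsection \<open>The unbounded branch\<close>

lemma topspace_pair_space [simp]: "topspace pair_space = mspace C2pi \<times> {0<..}"
  by (simp add: pair_space_def)

lemma mdist_loop:
  "mdist C2pi (loop k f g h) (loop k f' g' h') \<le> norm (f - f') + norm (g - g') + norm (h - h')"
  unfolding C2pi_def mdist_submetric
proof (rule mdist_cfunspace_le)
  fix t assume "t \<in> topspace (top_of_set {0..2 * pi})"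
  then have t: "t \<in> {0..2*pi}" by simp
  have *: "\<bar>F x - G x\<bar> \<le> norm (F - G)" for F G :: bfun and x
    using abs_bfun_le[of "F - G" x] by simp
  have "curve k f g h t - curve k f' g' h' t = (f (real k * t) - f' (real k * t)) *\<^sub>R axis 1 1
      + (g (real k * t) - g' (real k * t)) *\<^sub>R axis 3 1 + (h (real k * t) - h' (real k * t)) *\<^sub>R axis 4 1"
    by (simp add: curve_def algebra_simps)
  also have "norm \<dots> \<le> \<bar>f (real k * t) - f' (real k * t)\<bar> + \<bar>g (real k * t) - g' (real k * t)\<bar> + \<bar>h (real k * t) - h' (real k * t)\<bar>"
    by (intro order_trans[OF norm_triangle_ineq] add_mono) (simp_all add: norm_axis_1)
  also have "\<dots> \<le> norm (f - f') + norm (g - g') + norm (h - h')" by (intro add_mono *)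
  finally show "mdist euclidean_metric (loop k f g h t) (loop k f' g' h' t) \<le> norm (f - f') + norm (g - g') + norm (h - h')"
    using t by (simp add: loop_def dist_norm)
qed simp

lemma continuous_map_loop:
  assumes cont: "continuous_on S f" "continuous_on S g" "continuous_on S h"
    and ev: "\<And>w. w \<in> S \<Longrightarrow> even_periodic (f w) \<and> even_periodic (g w) \<and> even_periodic (h w)"
  shows "continuous_map (top_of_set S) (mtopology_of C2pi) (\<lambda>w. loop k (f w) (g w) (h w))"
proof -
  interpret M: Metric_space "mspace C2pi" "mdist C2pi :: (real \<Rightarrow> real^4) \<Rightarrow> _" by (rule Metric_space_mspace_mdist)
  show ?thesis
    unfolding mtopology_of_def M.continuous_map_to_metric
  proof (intro ballI allI impI)
    fix x and e :: real assume "x \<in> topspace (top_of_set S)" and e: "0 < e"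
    then have x: "x \<in> S" by simp
    define d where "d = (\<lambda>w. norm (f x - f w) + norm (g x - g w) + norm (h x - h w))"
    have "continuous_on S d" unfolding d_def by (intro continuous_intros cont)
    then have "openin (top_of_set S) {w \<in> S. d w \<in> {..<e}}"
      using continuous_openin_preimage[of S d UNIV "{..<e}"] by (simp add: vimage_def Int_def)
    moreover have "loop k (f w) (g w) (h w) \<in> M.mball (loop k (f x) (g x) (h x)) e" if "w \<in> S" "d w < e" for w
      using mdist_loop[of k "f x" "g x" "h x" "f w" "g w" "h w"] ev[OF x] ev[OF that(1)] that(2)
      by (auto simp: d_def intro!: loop_in_C2pi)
    ultimately show "\<exists>U. openin (top_of_set S) U \<and> x \<in> U \<and>
        (\<forall>y\<in>U. loop k (f y) (g y) (h y) \<in> M.mball (loop k (f x) (g x) (h x)) e)"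
      using x e by (intro exI[of _ "{w \<in> S. d w \<in> {..<e}}"]) (auto simp: d_def)
  qed
qed

context
  fixes U :: "real^4 \<Rightarrow> real" and k :: nat
  assumes U: "U = (\<lambda>x. - (x$3) * ((x$1)\<^sup>2 + (x$2)\<^sup>2) + 1/3 * (x$3)^3 + 1/2 * (x$4 - x$3)\<^sup>2)"
    and k: "1 \<le> k"
begin

text \<open>The shift, the Lipschitz constant and the state set depend on R, so each R has its own
  connected set. All of these contain the same base point, which places them in one
  component.\<close>

lemma branch:
  assumes R: "0 < R"
  shows "\<exists>D u l. connectedin pair_space D \<and> D \<subseteq> cl_NT U \<and> (const2pi 0, k / sqrt 2) \<in> D \<and> (u, l) \<in> D \<and>
    R = u 0 $ 3 - u (pi / k) $ 3 + (u (pi / k) $ 4 - u 0 $ 4)"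
proof -
  \<comment> \<open>Any shift with \<nu>^2 > 4 R would do.\<close>
  define \<nu> where "\<nu> = sqrt (4 * R + 1)"
  define L where "L = 2 * (1 + \<nu>\<^sup>2) * pi"
  have \<nu>: "0 < \<nu>" "4 * R < \<nu>\<^sup>2" using R by (simp_all add: \<nu>_def)
  have "1 * 1 \<le> (2 * (1 + \<nu>\<^sup>2)) * pi" using pi_ge_two by (intro mult_mono) auto
  then have L: "2 * (1 + \<nu>\<^sup>2) * pi \<le> L" "1 \<le> L" by (simp_all add: L_def)
  have maps: "step \<nu> r z \<in> states L" if "r \<in> {0..R}" "z \<in> states L" for r z
    using that step_in[OF \<nu> _ _ L(1)] by (cases z) auto
  have "\<exists>C. connected C \<and> C \<subseteq> {(r, z). r \<in> {0..R} \<and> z \<in> states L \<and> step \<nu> r z = z} \<and>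
      (\<exists>z. (0, z) \<in> C) \<and> (\<exists>z. (R, z) \<in> C)"
    by (intro fixed_point_continuation compact_states convex_states states_nonempty L R
        continuous_on_step \<nu> maps) (use L R in auto)
  then obtain C z0 z1 where C: "connected C" "C \<subseteq> {(r, z). r \<in> {0..R} \<and> z \<in> states L \<and> step \<nu> r z = z}"
    and z0: "(0, z0) \<in> C" and z1: "(R, z1) \<in> C"
    by (elim exE conjE) (rule that)
  have fs: "fixed_state \<nu> R r L \<mu> p q s k U" if "(r, \<mu>, p, q, s) \<in> C" for r \<mu> p q s
    using that C(2) \<nu> L U k by unfold_locales auto
  have solNT: "sol k w \<in> NT U" if "w \<in> C" "0 < fst w" for w
    using that fixed_state.sol_in_NT[OF fs] by (cases w) auto
  have sol0: "sol k w = (const2pi 0, k / sqrt 2)" if "w \<in> C" "fst w = 0" for w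
    using that fixed_state.sol_0[OF fs] by (cases w) auto
  have fst_C: "0 \<le> fst w" if "w \<in> C" for w using C(2) that by auto
  have cont: "continuous_map (top_of_set C) pair_space (sol k)"
    unfolding pair_space_def continuous_map_pairwise
  proof
    have [continuous_intros]: "Int_pi (bmult (fst (snd (snd w))) (fst (snd (snd w)))) \<noteq> 0" if "w \<in> C" for w
      using that Int_pp_pos[OF \<nu> _ _ L(1)] C(2) by (cases w) fastforce
    have "fst \<circ> sol k = (\<lambda>w. loop k (x1_part (fst w) (fst (snd (snd w))) (fst (snd (snd (snd w)))))
        (x3_part (fst w) (fst (snd (snd w))) (fst (snd (snd (snd w)))))
        (x4_part (fst w) (fst (snd (snd w))) (fst (snd (snd (snd w)))) (snd (snd (snd (snd w))))))"
      by (simp add: fun_eq_iff sol_def)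
    moreover have "continuous_map (top_of_set C) (mtopology_of C2pi) (\<lambda>w. loop k (x1_part (fst w) (fst (snd (snd w))) (fst (snd (snd (snd w)))))
        (x3_part (fst w) (fst (snd (snd w))) (fst (snd (snd (snd w)))))
        (x4_part (fst w) (fst (snd (snd w))) (fst (snd (snd (snd w)))) (snd (snd (snd (snd w))))))"
    proof (rule continuous_map_loop)
      show "even_periodic (x1_part (fst w) (fst (snd (snd w))) (fst (snd (snd (snd w))))) \<and>
        even_periodic (x3_part (fst w) (fst (snd (snd w))) (fst (snd (snd (snd w))))) \<and>
        even_periodic (x4_part (fst w) (fst (snd (snd w))) (fst (snd (snd (snd w)))) (snd (snd (snd (snd w)))))"
        if "w \<in> C" for w
        using that fixed_state.parts_even[OF fs] by (cases w) auto
    qed (unfold x1_part_def x3_part_def x4_part_def, (intro continuous_intros | assumption)+)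
    ultimately show "continuous_map (top_of_set C) (mtopology_of C2pi) (fst \<circ> sol k)" by simp
    have "snd \<circ> sol k = (\<lambda>w. real k * sqrt (fst (snd w)))"
      by (simp add: fun_eq_iff sol_def)
    moreover have "0 < fst (snd w)" if "w \<in> C" for w
    proof -
      obtain r \<mu> p q s where w: "w = (r, \<mu>, p, q, s)" by (cases w)
      interpret fixed_state \<nu> R r L \<mu> p q s k U using fs that w by blast
      show ?thesis using mu_pos[OF \<nu> R r L z fixed] w by simp
    qed
    ultimately show "continuous_map (top_of_set C) (top_of_set {0<..}) (snd \<circ> sol k)"
      using k by (auto simp: continuous_map_in_subtopology intro!: continuous_intros)
  qed
  define D where "D = sol k ` C"
  have "connectedin pair_space D"
    unfolding D_def by (rule connectedin_continuous_map_image[OF cont]) (simp add: C connectedin_subtopology)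
  moreover have p0: "(const2pi 0, k / sqrt 2) \<in> D"
    using z0 sol0[OF z0] by (force simp: D_def)
  moreover have "D \<subseteq> cl_NT U"
  proof -
    have top: "sol k w \<in> topspace pair_space" if "w \<in> C" for w
      using continuous_map_image_subset_topspace[OF cont] that by auto
    have NT: "sol k w \<in> cl_NT U" if "w \<in> C" "0 < fst w" for w
      unfolding cl_NT_def in_closure_of using solNT[OF that] top[OF that(1)] by blast
    \<comment> \<open>A neighbourhood without nonstationary solutions would make the slice r = 0
      open in C. It is also closed, contains one end of C and misses the other, contradicting
      connectedness.\<close>
    have "(const2pi 0, k / sqrt 2) \<in> cl_NT U"
      unfolding cl_NT_def in_closure_of
    proof (intro conjI allI impI)
      show "(const2pi (0 :: real^4), k / sqrt 2) \<in> topspace pair_space" using top[OF z0] sol0[OF z0] by simp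
      fix W :: "((real \<Rightarrow> real^4) \<times> real) set"
      assume W: "(const2pi 0, k / sqrt 2) \<in> W \<and> openin pair_space W"
      show "\<exists>y. y \<in> NT U \<and> y \<in> W"
      proof (rule ccontr)
        assume no: "\<nexists>y. y \<in> NT U \<and> y \<in> W"
        have "sol k w \<in> W \<longleftrightarrow> fst w \<le> 0" if "w \<in> C" for w
        proof (cases "0 < fst w")
          case True
          then have "sol k w \<notin> W" using no solNT[OF that True] by blast
          then show ?thesis using True by simp
        next
          case False
          then show ?thesis using sol0[OF that] fst_C[OF that] W by simp
        qed
        then have "{w \<in> C. sol k w \<in> W} = {w \<in> C. fst w \<le> 0}" by blast
        moreover have "openin (top_of_set C) {w \<in> C. sol k w \<in> W}"
          using openin_continuous_map_preimage[OF cont, of W] W by simp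
        moreover have "closedin (top_of_set C) {w \<in> C. fst w \<le> 0}"
        proof -
          have "closed {w :: real \<times> real \<times> bfun \<times> bfun \<times> bfun. fst w \<le> 0}"
            by (intro closed_Collect_le continuous_intros)
          from closedin_closed_Int[OF this, of C] show ?thesis by (simp add: Int_def)
        qed
        ultimately have "{w \<in> C. fst w \<le> 0} = {} \<or> {w \<in> C. fst w \<le> 0} = C"
          using C(1)[unfolded connected_clopen, rule_format, of "{w \<in> C. fst w \<le> 0}"] by simp
        moreover have "(0, z0) \<in> {w \<in> C. fst w \<le> 0}" "(R, z1) \<notin> {w \<in> C. fst w \<le> 0}"
          using z0 R by simp_all
        ultimately show False using z1 by blast
      qed
    qed
    then have "sol k w \<in> cl_NT U" if "w \<in> C" for w
      using NT[OF that] sol0[OF that] fst_C[OF that] by (cases "fst w = 0") simp_all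
    then show ?thesis unfolding D_def by blast
  qed
  moreover have "\<exists>u l. (u, l) \<in> D \<and> R = u 0 $ 3 - u (pi / k) $ 3 + (u (pi / k) $ 4 - u 0 $ 4)"
  proof -
    obtain \<mu> p q s where w: "z1 = (\<mu>, p, q, s)" by (cases z1)
    interpret fixed_state \<nu> R R L \<mu> p q s k U using fs z1 w by blast
    define u where "u = loop k (x1_part R p q) (x3_part R p q) (x4_part R p q s)"
    have "sol k (R, z1) = (u, k * sqrt \<mu>)" by (simp add: u_def sol_def w)
    then have uD: "(u, k * sqrt \<mu>) \<in> D" using z1 unfolding D_def by (metis imageI)
    have in2: "0 \<in> {0..2*pi}" "pi / k \<in> {0..2*pi}"
      using k pi_ge_zero by (auto simp: field_simps intro: order_trans[of pi "pi * 2"] mult_mono)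
    have "u 0 $ 3 - u (pi / k) $ 3 + (u (pi / k) $ 4 - u 0 $ 4) = osc (x4_part R p q s) - osc (x3_part R p q)"
      using in2 k by (simp add: u_def loop_def osc_def)
    also have "\<dots> = R * (osc q + osc s)" by (simp add: osc_parts algebra_simps)
    also have "\<dots> = R" using facts(13) by simp
    finally show ?thesis using uD by metis
  qed
  ultimately show ?thesis by blast
qed

lemma branch_subset_continuum:
  assumes "connectedin pair_space D" "D \<subseteq> cl_NT U" "(const2pi 0, k / sqrt 2) \<in> D"
  shows "D \<subseteq> continuum U 0 (k / sqrt 2)"
  unfolding continuum_def
  by (rule connected_component_of_maximal) (use assms in \<open>auto simp: connectedin_subtopology\<close>)

lemma continuum_not_compact: "\<not> compactin pair_space (continuum U 0 (k / sqrt 2))"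
proof
  interpret M: Metric_space "mspace C2pi" "mdist C2pi :: (real \<Rightarrow> real^4) \<Rightarrow> _" by (rule Metric_space_mspace_mdist)
  let ?S = "continuum U 0 (k / sqrt 2)"
  assume "compactin pair_space ?S"
  then have "compactin M.mtopology (fst ` ?S)"
    using image_compactin[of pair_space ?S "mtopology_of C2pi" fst]
    by (simp add: pair_space_def continuous_map_fst mtopology_of_def)
  then have "M.mbounded (fst ` ?S)" by (rule M.compactin_imp_mbounded)
  then obtain B where sub: "fst ` ?S \<subseteq> mspace C2pi" and B: "\<And>u v. u \<in> fst ` ?S \<Longrightarrow> v \<in> fst ` ?S \<Longrightarrow> mdist C2pi u v \<le> B"
    unfolding M.mbounded_alt by blast
  \<comment> \<open>The oscillation is a signed sum of four component values, each at most B in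
    absolute value, so 4 |B| + 1 is out of reach.\<close>
  obtain D u l where D: "connectedin pair_space D" "D \<subseteq> cl_NT U" "(const2pi 0, k / sqrt 2) \<in> D" "(u, l) \<in> D"
    and u: "4 * \<bar>B\<bar> + 1 = u 0 $ 3 - u (pi / k) $ 3 + (u (pi / k) $ 4 - u 0 $ 4)"
  proof -
    have "0 < 4 * \<bar>B\<bar> + 1" by simp
    from branch[OF this] show ?thesis by (elim exE conjE) (rule that)
  qed
  have DS: "D \<subseteq> ?S" by (rule branch_subset_continuum[OF D(1-3)])
  have in2: "0 \<in> {0..2*pi}" "pi / k \<in> {0..2*pi}"
    using k pi_ge_zero by (auto simp: field_simps intro: order_trans[of pi "pi * 2"] mult_mono)
  have mem: "u \<in> fst ` ?S" "const2pi 0 \<in> fst ` ?S" using D(3,4) DS by force+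
  have le: "\<bar>u t $ i\<bar> \<le> B" if "t \<in> {0..2*pi}" for t i
  proof -
    have "mdist euclidean_metric (u t) (const2pi 0 t) \<le> B"
    proof (rule mdist_cfunspace_imp_mdist_le[where f = u and g = "const2pi 0" and X = "top_of_set {0..2*pi}"])
      show "mdist (cfunspace (top_of_set {0..2*pi}) euclidean_metric) u (const2pi 0) \<le> B"
        using B[OF mem] by (simp add: C2pi_def)
    qed (use sub mem that in \<open>auto simp: C2pi_def simp del: mspace_cfunspace\<close>)
    then show ?thesis
      using that component_le_norm_cart[of "u t" i] by (simp add: const2pi_def dist_norm)
  qed
  show False
    using u le[OF in2(1), of 3] le[OF in2(1), of 4] le[OF in2(2), of 3] le[OF in2(2), of 4] by linarith
qed

end

theorem corollary4p7:
  fixes U :: "real^4 \<Rightarrow> real" and k :: nat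
  assumes "U = (\<lambda>x. - (x$3) * ((x$1)\<^sup>2 + (x$2)\<^sup>2) + 1/3 * (x$3)^3 + 1/2 * (x$4 - x$3)\<^sup>2)"
    and "k \<ge> 1"
  shows "(const2pi 0, k / sqrt 2) \<in> cl_NT U \<and>
    \<not> compactin pair_space (continuum U 0 (k / sqrt 2))"
  using branch[OF assms zero_less_one] continuum_not_compact[OF assms] by blast

end
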